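(* Let $\mathcal{F}$ be the smallest family of finite posets that contains every $\mathbf{X}$-free finite poset and is closed under disjoint unions and ordinal sums (i.e. if $A,B\in\mathcal{F}$ then $A\sqcup B\in\mathcal{F}$ and $(A<B)\in\mathcal{F}$). Then every poset $P\in\mathcal{F}$ satisfies \[ s_k(\mathcal{O}(P)) \le s_k(\mathcal{C}(P)) \] for all $k\ge 0$.
   Context: All posets are finite. $\mathbf{X}$ denotes the five-element poset $\{a,b,c,d,e\}$ with $a<c$, $b<c$, $c<d$, $c<e$ (and the relations implied by transitivity), where $a,b$ are incomparable and $d,e$ are incomparable. A poset is $\mathbf{X}$-free if it contains no subposet isomorphic to $\mathbf{X}$. $A\sqcup B$ is the disjoint union of posets and $A<B$ is the ordinal sum (the disjoint union in which additionally every element of $A$ is below every element of $B$). For a poset $P$, the order polytope is $\mathcal{O}(P)=\{x\in\mathbb{R}^P: 0\le x_p\le 1 \text{ for all } p,\ x_p\le x_q \text{ if } p\le q\}$ and the chain polytope is $\mathcal{C}(P)=\{x\in\mathbb{R}^P: x_p\ge 0 \text{ for all } p,\ x_{p_1}+\dots+x_{p_k}\le 1 \text{ whenever } p_1<\dots<p_k \text{ in } P\}$. For a polytope $\mathcal{P}$, $s_k(\mathcal{P})$ denotes the number of $k$-dimensional faces of $\mathcal{P}$ that are simplices. *)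

theory Defs
  imports "HOL-Analysis.Analysis"
begin

text \<open>
  A finite poset is a carrier \<open>A\<close> with a relation \<open>r\<close> such that \<open>finite A\<close> and
  \<open>partial_order_on A r\<close>; the latter includes \<open>r \<subseteq> A \<times> A\<close>, and \<open>(p, q) \<in> r\<close> means
  \<open>p \<le> q\<close>.
\<close>

datatype X_elem = Xa | Xb | Xc | Xd | Xe

definition X_le :: "X_elem rel" where
  "X_le = {(Xa, Xc), (Xb, Xc), (Xc, Xd), (Xc, Xe)}\<^sup>*"

definition poset_isomorphic :: "'a set \<Rightarrow> 'a rel \<Rightarrow> 'b set \<Rightarrow> 'b rel \<Rightarrow> bool" where
  "poset_isomorphic A r B s \<longleftrightarrow>
     (\<exists>f. bij_betw f A B \<and> (\<forall>x\<in>A. \<forall>y\<in>A. (x, y) \<in> r \<longleftrightarrow> (f x, f y) \<in> s))"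

definition X_free :: "'a set \<Rightarrow> 'a rel \<Rightarrow> bool" where
  "X_free A r \<longleftrightarrow> \<not> (\<exists>B\<subseteq>A. poset_isomorphic UNIV X_le B (Restr r B))"

text \<open>
  The family is formed inside one ambient type. Nothing is lost: the class is invariant under
  isomorphism, and the summands of a disjoint union or ordinal sum live on complementary subsets
  of its carrier.
\<close>

inductive X_family :: "'a set \<Rightarrow> 'a rel \<Rightarrow> bool" where
  X_free: "finite A \<Longrightarrow> partial_order_on A r \<Longrightarrow> X_free A r \<Longrightarrow> X_family A r"
| disjoint_union:
    "X_family A r \<Longrightarrow> X_family B s \<Longrightarrow> A \<inter> B = {} \<Longrightarrow> X_family (A \<union> B) (r \<union> s)"
| ordinal_sum:
    "X_family A r \<Longrightarrow> X_family B s \<Longrightarrow> A \<inter> B = {} \<Longrightarrow> X_family (A \<union> B) (r \<union> s \<union> A \<times> B)"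

text \<open>
  For a carrier \<open>A\<close> inside a finite type \<open>'n\<close>, the space of real vectors indexed by \<open>A\<close> is
  identified with the coordinate subspace of \<open>real ^ 'n\<close> on which the coordinates outside \<open>A\<close>
  vanish. For \<open>A = UNIV\<close> this is the whole space; \<open>A = {}\<close> gives the empty poset.
\<close>

definition coord_space :: "'n::finite set \<Rightarrow> (real ^ 'n) set" where
  "coord_space A = {x. \<forall>p. p \<notin> A \<longrightarrow> x $ p = 0}"

definition order_polytope :: "'n::finite set \<Rightarrow> 'n rel \<Rightarrow> (real ^ 'n) set" where
  "order_polytope A r =
     {x \<in> coord_space A.
        (\<forall>p\<in>A. 0 \<le> x $ p \<and> x $ p \<le> 1) \<and>
        (\<forall>p\<in>A. \<forall>q\<in>A. (p, q) \<in> r \<longrightarrow> x $ p \<le> x $ q)}"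

definition chain_polytope :: "'n::finite set \<Rightarrow> 'n rel \<Rightarrow> (real ^ 'n) set" where
  "chain_polytope A r =
     {x \<in> coord_space A.
        (\<forall>p\<in>A. 0 \<le> x $ p) \<and>
        (\<forall>ps. set ps \<subseteq> A \<and> sorted_wrt (\<lambda>p q. (p, q) \<in> r \<and> p \<noteq> q) ps
              \<longrightarrow> (\<Sum>p\<leftarrow>ps. x $ p) \<le> 1)}"

definition simplex_face_count :: "nat \<Rightarrow> 'a::euclidean_space set \<Rightarrow> nat" where
  "simplex_face_count k S = card {T. T face_of S \<and> int k simplex T}"

end

theory Submission
  imports Defs
begin

text \<open>
  Disjoint unions become products of polytopes, and a face of a product is a simplex iff one factor
  is a simplex and the other a vertex. An ordinal sum \<open>A < B\<close> becomes a wedge: both polytopes are the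
  convex hull of the polytopes of \<open>A\<close> and \<open>B\<close>, placed in complementary affine subspaces that meet in
  one common vertex. If \<open>p i\<close> and \<open>q i\<close> count the simplex faces with \<open>i\<close> vertices besides the
  common one that contain, respectively avoid, that vertex, the wedge has
  \<open>\<Sum>i\<le>k. p i * p' (k - i)\<close> simplex faces of dimension \<open>k\<close> through the vertex and
  \<open>\<Sum>i\<le>Suc k. q i * q' (Suc k - i)\<close> avoiding it. Since \<open>p i \<le> q i\<close>, the total is increasing in the
  number of simplex faces of each summand and decreasing in the number of those through the vertex.
  The simplex faces of the chain polytope through \<open>0\<close> correspond to the chains of the poset, and each
  chain also yields a simplex face of the order polytope spanned by principal filters; so the order
  polytope has at least as many through the common vertex. For \<open>X\<close>-free posets the two polytopes
  are affinely equivalent.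
\<close>

section \<open>Simplex faces as vertex sets\<close>

text \<open>The obstacle is that the count for an ordinal sum depends on how the simplex faces of
  each summand are divided by the common vertex, so the totals of the summands do not determine it.
  The bare inequality is nevertheless a sufficient induction hypothesis, because the comparison of
  faces through the vertex holds for every finite poset and needs no induction. In the order
  polytope of \<open>A < B\<close> the common vertex is the indicator of \<open>B\<close>: the zero
  vertex for \<open>A\<close>, but the all-ones vertex for \<open>B\<close>. Reflecting x to 1 - x
  turns the latter into the origin of the order polytope of the dual of \<open>B\<close>, which has
  the same chains; this is where the converse relation and the negation come from. In the chain
  polytope both vertices are the origin already. The inequality \<open>p i <= q i\<close> comes from
  deleting the common vertex from a simplex. In the final estimate a face through the vertex is
  traded for one of the same dimension avoiding it, which has one more vertex besides the common
  one; this accounts for the shift by \<open>Suc\<close>.\<close>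

definition simplex_vertex_sets :: "'a::euclidean_space set \<Rightarrow> 'a set set" where
  "simplex_vertex_sets S = {C. \<not> affine_dependent C \<and> convex hull C face_of S}"

text \<open>Both counts are indexed by the number of nonzero vertices, since this number is additive
  in a wedge. The dimension is therefore \<open>k\<close> for faces at the origin and
  \<open>k - 1\<close> for faces off it.\<close>

definition faces_at_origin :: "nat \<Rightarrow> 'a::euclidean_space set \<Rightarrow> nat" where
  "faces_at_origin k S = card {C \<in> simplex_vertex_sets S. 0 \<in> C \<and> card C = Suc k}"

definition faces_off_origin :: "nat \<Rightarrow> 'a::euclidean_space set \<Rightarrow> nat" where
  "faces_off_origin k S = card {C \<in> simplex_vertex_sets S. 0 \<notin> C \<and> card C = k}"

lemma simplex_vertex_setsD:
  assumes "C \<in> simplex_vertex_sets S"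
  shows "\<not> affine_dependent C" "convex hull C face_of S" "finite C" "C \<subseteq> S"
proof -
  show C: "\<not> affine_dependent C" "convex hull C face_of S"
    using assms by (auto simp: simplex_vertex_sets_def)
  show "finite C"
    using C(1) aff_independent_finite by blast
  show "C \<subseteq> S"
    using face_of_imp_subset[OF C(2)] hull_subset[of C convex] by blast
qed

text \<open>Extreme points of a face are the extreme points of \<open>S\<close> lying in it, and
  those of a simplex are its vertices. This is how a specific point is recognised as a vertex later
  on.\<close>

lemma mem_simplex_vertex_set_iff:
  assumes "C \<in> simplex_vertex_sets S"
  shows "x \<in> C \<longleftrightarrow> x extreme_point_of S \<and> x \<in> convex hull C"
  using simplex_vertex_setsD(1,2)[OF assms]
  by (metis extreme_point_of_convex_hull_affine_independent extreme_point_of_face)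

lemma simplex_vertex_sets_subset:
  assumes "C \<in> simplex_vertex_sets S" "C' \<subseteq> C"
  shows "C' \<in> simplex_vertex_sets S"
proof -
  have "convex hull C' face_of convex hull C"
    using assms simplex_vertex_setsD(1) face_of_convex_hull_affine_independent by blast
  then show ?thesis
    using assms simplex_vertex_setsD[OF assms(1)] affine_dependent_subset face_of_trans
    unfolding simplex_vertex_sets_def by blast
qed

text \<open>The set is recovered from its hull as the set of extreme points, so counting vertex sets
  is counting faces.\<close>

lemma inj_on_convex_hull_affine_independent:
  "inj_on (\<lambda>C::'a::euclidean_space set. convex hull C) {C. \<not> affine_dependent C}"
  by (rule inj_onI) (metis (mono_tags) mem_Collect_eq extreme_point_of_convex_hull_affine_independent set_eqI)

lemma finite_simplex_vertex_sets:
  assumes "polyhedron S"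
  shows "finite (simplex_vertex_sets S)"
proof (rule finite_imageD)
  show "finite ((hull) convex ` simplex_vertex_sets S)"
    by (rule finite_subset[OF _ finite_polyhedron_faces[OF assms]])
       (auto simp: simplex_vertex_sets_def)
  show "inj_on ((hull) convex) (simplex_vertex_sets S)"
    by (rule inj_on_subset[OF inj_on_convex_hull_affine_independent])
       (auto simp: simplex_vertex_sets_def)
qed

lemma simplex_face_count_eq:
  "simplex_face_count k S = card {C \<in> simplex_vertex_sets S. card C = Suc k}"
proof -
  have "bij_betw ((hull) convex) {C \<in> simplex_vertex_sets S. card C = Suc k}
          {T. T face_of S \<and> int k simplex T}"
    unfolding bij_betw_def
  proof
    show "inj_on ((hull) convex) {C \<in> simplex_vertex_sets S. card C = Suc k}"
      by (rule inj_on_subset[OF inj_on_convex_hull_affine_independent])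
         (auto simp: simplex_vertex_sets_def)
    show "(hull) convex ` {C \<in> simplex_vertex_sets S. card C = Suc k}
          = {T. T face_of S \<and> int k simplex T}"
      by (auto simp: simplex_vertex_sets_def simplex_def image_iff)
  qed
  from bij_betw_same_card[OF this] show ?thesis
    by (simp add: simplex_face_count_def)
qed

lemma simplex_face_count_split:
  assumes "finite (simplex_vertex_sets S)"
  shows "simplex_face_count k S = faces_at_origin k S + faces_off_origin (Suc k) S"
proof -
  have "{C \<in> simplex_vertex_sets S. card C = Suc k} =
      {C \<in> simplex_vertex_sets S. 0 \<in> C \<and> card C = Suc k} \<union>
      {C \<in> simplex_vertex_sets S. 0 \<notin> C \<and> card C = Suc k}"
    by auto
  then show ?thesis
    unfolding simplex_face_count_eq faces_at_origin_def faces_off_origin_def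
    using assms by (subst card_Un_disjoint[symmetric]) auto
qed

text \<open>The empty face. In the convolution for faces off the vertex it pairs with the faces that
  lie in one factor only, and it makes the boundary terms of both polytopes agree.\<close>

lemma faces_off_origin_0: "faces_off_origin 0 S = 1"
proof -
  have "{C \<in> simplex_vertex_sets S. 0 \<notin> C \<and> card C = 0} = {{}}"
    using simplex_vertex_setsD(3) by (fastforce simp: simplex_vertex_sets_def)
  then show ?thesis by (simp add: faces_off_origin_def)
qed

text \<open>A simplex face through the origin is determined by its facet opposite to the origin.\<close>

lemma faces_at_origin_le_faces_off_origin:
  assumes "polyhedron S"
  shows "faces_at_origin k S \<le> faces_off_origin k S"
  unfolding faces_at_origin_def faces_off_origin_def
proof (rule card_inj_on_le)
  show "inj_on (\<lambda>C. C - {0}) {C \<in> simplex_vertex_sets S. 0 \<in> C \<and> card C = Suc k}"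
    by (rule inj_onI) (metis (mono_tags, lifting) mem_Collect_eq insert_Diff)
  show "(\<lambda>C. C - {0}) ` {C \<in> simplex_vertex_sets S. 0 \<in> C \<and> card C = Suc k}
      \<subseteq> {C \<in> simplex_vertex_sets S. 0 \<notin> C \<and> card C = k}"
    using simplex_vertex_sets_subset[of _ S] simplex_vertex_setsD(3) by auto
qed (use finite_simplex_vertex_sets[OF assms] in auto)

section \<open>Transport of simplex faces along linear maps and translations\<close>

lemma affine_independent_linear_image:
  fixes f :: "'a::real_vector \<Rightarrow> 'b::real_vector"
  assumes g: "linear g" and gf: "\<And>x. x \<in> C \<Longrightarrow> g (f x) = x"
    and C: "\<not> affine_dependent C" "finite C"
  shows "\<not> affine_dependent (f ` C)"
proof
  assume "affine_dependent (f ` C)"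
  then obtain U v where U: "sum U (f ` C) = 0" "v \<in> f ` C" "U v \<noteq> 0"
      "(\<Sum>v\<in>f ` C. U v *\<^sub>R v) = 0"
    using affine_dependent_explicit_finite[of "f ` C"] C(2) by auto
  have inj: "inj_on f C"
    by (metis gf inj_on_inverseI)
  \<comment> \<open>Applying \<open>g\<close> pulls the relation back to \<open>C\<close> with the
    same coefficients.\<close>
  have "0 = g (\<Sum>v\<in>f ` C. U v *\<^sub>R v)"
    by (simp add: U(4) linear_0[OF g])
  also have "\<dots> = (\<Sum>x\<in>C. U (f x) *\<^sub>R x)"
    using gf by (simp add: linear_sum[OF g] linear_scale[OF g] sum.reindex[OF inj])
  finally have "(\<Sum>x\<in>C. U (f x) *\<^sub>R x) = 0" by simp
  moreover have "sum (U \<circ> f) C = 0"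
    using U(1) by (simp add: sum.reindex[OF inj])
  ultimately have "affine_dependent C"
    using U(2,3) affine_dependent_explicit_finite[OF C(2)] by (auto intro!: exI[of _ "U \<circ> f"])
  with C(1) show False by simp
qed

lemma simplex_vertex_sets_linear_image:
  fixes f :: "'a::euclidean_space \<Rightarrow> 'b::euclidean_space"
  assumes f: "linear f" and g: "linear g" and gf: "\<And>x. x \<in> S \<Longrightarrow> g (f x) = x"
    and C: "C \<in> simplex_vertex_sets S"
  shows "f ` C \<in> simplex_vertex_sets (f ` S)"
proof -
  note C' = simplex_vertex_setsD[OF C]
  have "\<not> affine_dependent (f ` C)"
    using C' gf by (intro affine_independent_linear_image[OF g]) auto
  moreover have "f ` (convex hull C) face_of f ` S"
    unfolding face_of_def
  proof (intro conjI ballI impI)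
    have sub: "convex hull C \<subseteq> S" by (rule face_of_imp_subset[OF C'(2)])
    then show "f ` (convex hull C) \<subseteq> f ` S" by blast
    show "convex (f ` (convex hull C))"
      by (simp add: convex_linear_image f)
    fix a b x assume ab: "a \<in> f ` S" "b \<in> f ` S" and x: "x \<in> f ` (convex hull C)"
      and seg: "x \<in> open_segment a b"
    obtain a' b' x' where eqs: "a = f a'" "b = f b'" "x = f x'"
      and mem: "a' \<in> S" "b' \<in> S" "x' \<in> convex hull C"
      using ab x by auto
    obtain u where u: "0 < u" "u < 1" "x = (1 - u) *\<^sub>R a + u *\<^sub>R b" and "a \<noteq> b"
      using seg by (auto simp: in_segment)
    have "g x = (1 - u) *\<^sub>R g a + u *\<^sub>R g b"
      by (simp add: u(3) linear_add[OF g] linear_scale[OF g])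
    moreover have "g x = x'" "g a = a'" "g b = b'"
      using eqs mem sub gf by auto
    ultimately have "x' \<in> open_segment a' b'"
      using u eqs \<open>a \<noteq> b\<close> by (auto simp: in_segment)
    then show "a \<in> f ` (convex hull C)" "b \<in> f ` (convex hull C)"
      using face_ofD[OF C'(2) _ mem(1,2,3)] eqs by auto
  qed
  ultimately show ?thesis
    by (simp add: simplex_vertex_sets_def convex_hull_linear_image[OF f])
qed

text \<open>The predicates \<open>P\<close> and \<open>Q\<close> let one bijection serve both the
  count by number of vertices and the count that also fixes whether the origin is a vertex.\<close>

lemma bij_betw_simplex_vertex_sets_linear_image:
  fixes f :: "'a::euclidean_space \<Rightarrow> 'b::euclidean_space"
  assumes f: "linear f" and g: "linear g" and gf: "\<And>x. x \<in> S \<Longrightarrow> g (f x) = x"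
    and P: "\<And>C. C \<in> simplex_vertex_sets S \<Longrightarrow> P C \<longleftrightarrow> Q (f ` C)"
  shows "bij_betw ((`) f) {C \<in> simplex_vertex_sets S. P C} {C \<in> simplex_vertex_sets (f ` S). Q C}"
proof (rule bij_betw_byWitness[where f' = "(`) g"])
  have gfC: "g ` f ` C = C" if "C \<subseteq> S" for C
    using that gf by (force simp: image_iff)
  have fgC: "f ` g ` C = C" if "C \<subseteq> f ` S" for C
    using that gf by (force simp: image_iff subset_iff)
  show "\<forall>C\<in>{C \<in> simplex_vertex_sets S. P C}. g ` f ` C = C"
    by (auto dest!: simplex_vertex_setsD(4) intro!: gfC)
  show "\<forall>C\<in>{C \<in> simplex_vertex_sets (f ` S). Q C}. f ` g ` C = C"
    by (auto dest!: simplex_vertex_setsD(4) intro!: fgC)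
  show "(`) f ` {C \<in> simplex_vertex_sets S. P C} \<subseteq> {C \<in> simplex_vertex_sets (f ` S). Q C}"
    using simplex_vertex_sets_linear_image[OF f g gf] P by auto
  have "g ` C \<in> simplex_vertex_sets S" if "C \<in> simplex_vertex_sets (f ` S)" for C
  proof -
    have "g ` C \<in> simplex_vertex_sets (g ` f ` S)"
      by (rule simplex_vertex_sets_linear_image[OF g f _ that]) (use gf in auto)
    then show ?thesis by (simp add: gfC)
  qed
  then show "(`) g ` {C \<in> simplex_vertex_sets (f ` S). Q C} \<subseteq> {C \<in> simplex_vertex_sets S. P C}"
    using P fgC[OF simplex_vertex_setsD(4)] by auto
qed

lemma card_image_left_inverse:
  assumes "\<And>x. x \<in> S \<Longrightarrow> g (f x) = x" "C \<subseteq> S"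
  shows "card (f ` C) = card C"
  using assms by (intro card_image) (metis inj_on_inverseI subset_iff)

lemma simplex_face_count_linear_image:
  fixes f :: "'a::euclidean_space \<Rightarrow> 'b::euclidean_space"
  assumes "linear f" "linear g" "\<And>x. x \<in> S \<Longrightarrow> g (f x) = x"
  shows "simplex_face_count k (f ` S) = simplex_face_count k S"
proof -
  have "card C = Suc k \<longleftrightarrow> card (f ` C) = Suc k" if "C \<in> simplex_vertex_sets S" for C
    using card_image_left_inverse[of S g f, OF assms(3) simplex_vertex_setsD(4)[OF that]] by simp
  from bij_betw_simplex_vertex_sets_linear_image[where P = "\<lambda>C. card C = Suc k"
      and Q = "\<lambda>C. card C = Suc k", OF assms this, THEN bij_betw_same_card]
  show ?thesis by (simp add: simplex_face_count_eq)
qed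

lemma faces_at_origin_uminus_image:
  fixes S :: "'a::euclidean_space set"
  shows "faces_at_origin k (uminus ` S) = faces_at_origin k S"
proof -
  have lin: "linear (uminus :: 'a \<Rightarrow> 'a)"
    by (simp add: linear_iff)
  have "bij_betw ((`) uminus) {C \<in> simplex_vertex_sets S. 0 \<in> C \<and> card C = Suc k}
          {C \<in> simplex_vertex_sets (uminus ` S). 0 \<in> C \<and> card C = Suc k}"
    by (rule bij_betw_simplex_vertex_sets_linear_image[OF lin lin])
       (auto simp: image_iff card_image)
  from bij_betw_same_card[OF this] show ?thesis
    by (simp add: faces_at_origin_def)
qed

lemma simplex_face_count_translation:
  fixes S :: "'a::euclidean_space set"
  shows "simplex_face_count k ((+) a ` S) = simplex_face_count k S"
proof -
  have *: "(+) a ` C \<in> simplex_vertex_sets ((+) a ` S)" if "C \<in> simplex_vertex_sets S"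
    for a and C S :: "'a set"
    using that
    by (simp add: simplex_vertex_sets_def convex_hull_translation
        affine_dependent_translation_eq[of C a, symmetric])
  have "bij_betw ((`) ((+) a)) {C \<in> simplex_vertex_sets S. card C = Suc k}
          {C \<in> simplex_vertex_sets ((+) a ` S). card C = Suc k}"
  proof (rule bij_betw_byWitness[where f' = "(`) ((+) (- a))"])
    show "(`) ((+) (- a)) ` {C \<in> simplex_vertex_sets ((+) a ` S). card C = Suc k}
          \<subseteq> {C \<in> simplex_vertex_sets S. card C = Suc k}"
      using *[of _ "(+) a ` S" "- a"] by (auto simp: image_image card_image)
  qed (use *[of _ S a] in \<open>auto simp: image_image card_image\<close>)
  from bij_betw_same_card[OF this] show ?thesis
    by (simp add: simplex_face_count_eq)
qed

section \<open>Products\<close>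

lemma affine_dependent_Times_singleton:
  fixes C :: "'a::euclidean_space set" and b :: "'b::euclidean_space"
  shows "affine_dependent (C \<times> {b}) \<longleftrightarrow> affine_dependent C"
proof -
  have eq: "C \<times> {b} = (+) (0, b) ` (\<lambda>x. (x, 0)) ` C"
    by (auto simp: image_image)
  have "affine_dependent (C \<times> {b}) \<longleftrightarrow> affine_dependent ((\<lambda>x. (x, 0::'b)) ` C)"
    unfolding eq by (simp add: affine_dependent_translation_eq[symmetric])
  also have "\<dots> \<longleftrightarrow> affine_dependent C"
  proof -
    have "\<not> affine_dependent ((\<lambda>x. (x, 0::'b)) ` C)" if "\<not> affine_dependent C"
      using that aff_independent_finite[OF that]
      by (intro affine_independent_linear_image[where g = fst]) (auto simp: linear_fst)
    moreover have "\<not> affine_dependent C" if "\<not> affine_dependent ((\<lambda>x. (x, 0::'b)) ` C)"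
    proof -
      have "linear (\<lambda>x::'a. (x, 0::'b))"
        by (simp add: linear_iff)
      then have "\<not> affine_dependent (fst ` (\<lambda>x. (x, 0::'b)) ` C)"
        by (rule affine_independent_linear_image[OF _ _ that aff_independent_finite[OF that]]) auto
      then show ?thesis by (simp add: image_image)
    qed
    ultimately show ?thesis by blast
  qed
  finally show ?thesis .
qed

lemma affine_dependent_singleton_Times:
  fixes C :: "'a::euclidean_space set" and b :: "'b::euclidean_space"
  shows "affine_dependent ({b} \<times> C) \<longleftrightarrow> affine_dependent C"
proof -
  have lin: "linear (prod.swap :: 'a \<times> 'b \<Rightarrow> 'b \<times> 'a)" "linear (prod.swap :: 'b \<times> 'a \<Rightarrow> 'a \<times> 'b)"
    by (auto simp: linear_iff)
  have eq: "{b} \<times> C = prod.swap ` (C \<times> {b})" "C \<times> {b} = prod.swap ` ({b} \<times> C)"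
    by auto
  have "\<not> affine_dependent ({b} \<times> C) \<longleftrightarrow> \<not> affine_dependent (C \<times> {b})"
  proof
    assume *: "\<not> affine_dependent ({b} \<times> C)"
    show "\<not> affine_dependent (C \<times> {b})"
      unfolding eq(2)
      by (rule affine_independent_linear_image[OF lin(1) _ * aff_independent_finite[OF *]]) auto
  next
    assume *: "\<not> affine_dependent (C \<times> {b})"
    show "\<not> affine_dependent ({b} \<times> C)"
      unfolding eq(1)
      by (rule affine_independent_linear_image[OF lin(2) _ * aff_independent_finite[OF *]]) auto
  qed
  then show ?thesis by (simp add: affine_dependent_Times_singleton)
qed

lemma extreme_point_of_Times:
  fixes S :: "'a::euclidean_space set" and T :: "'b::euclidean_space set"
  shows "(a, b) extreme_point_of S \<times> T \<longleftrightarrow> a extreme_point_of S \<and> b extreme_point_of T"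
  using face_of_Times_eq[of "{a}" "{b}" S T] by (simp add: face_of_singleton)

text \<open>Four corners of a parallelogram: (a, b) = (a', b) + (a, b') - (a', b').\<close>

lemma affine_dependent_Times:
  fixes C :: "'a::euclidean_space set" and D :: "'b::euclidean_space set"
  assumes "a \<in> C" "a' \<in> C" "a \<noteq> a'" "b \<in> D" "b' \<in> D" "b \<noteq> b'"
  shows "affine_dependent (C \<times> D)"
proof -
  have "(a, b) \<in> affine hull {(a', b), (a, b'), (a', b')}"
    unfolding affine_hull_3
    by (rule CollectI, rule exI[of _ 1], rule exI[of _ 1], rule exI[of _ "-1"]) auto
  also have "\<dots> \<subseteq> affine hull (C \<times> D - {(a, b)})"
    by (rule hull_mono) (use assms in auto)
  finally show ?thesis
    using assms unfolding affine_dependent_def by blast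
qed

text \<open>A face of a product is a product of faces, and its vertices are the pairs of vertices,
  so \<open>C\<close> is the product of its two projections. If both had two points,
  \<open>C\<close> would contain a parallelogram.\<close>

lemma simplex_vertex_sets_TimesD:
  fixes S :: "'a::euclidean_space set" and T :: "'b::euclidean_space set"
  assumes C: "C \<in> simplex_vertex_sets (S \<times> T)" and ne: "C \<noteq> {}"
  shows "\<exists>C1\<in>simplex_vertex_sets S. \<exists>C2\<in>simplex_vertex_sets T.
           C = C1 \<times> C2 \<and> (card C1 = 1 \<or> card C2 = 1)"
proof -
  define C1 C2 where "C1 = fst ` C" and "C2 = snd ` C"
  note C' = simplex_vertex_setsD[OF C]
  obtain F F' where F: "convex hull C = F \<times> F'"
    using C'(2) unfolding face_of_Times_decomp by blast
  have eq: "C = C1 \<times> C2"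
  proof
    show "C \<subseteq> C1 \<times> C2"
      by (force simp: C1_def C2_def)
    show "C1 \<times> C2 \<subseteq> C"
    proof clarify
      fix a b assume "a \<in> C1" "b \<in> C2"
      then obtain a' b' where ab: "(a, b') \<in> C" "(a', b) \<in> C"
        by (auto simp: C1_def C2_def)
      then have "(a, b) extreme_point_of S \<times> T"
        using mem_simplex_vertex_set_iff[OF C] extreme_point_of_Times by metis
      moreover have "(a, b) \<in> convex hull C"
        using ab F hull_inc[of _ C convex] by (metis mem_Times_iff fst_conv snd_conv)
      ultimately show "(a, b) \<in> C"
        using mem_simplex_vertex_set_iff[OF C] by blast
    qed
  qed
  have ne': "C1 \<noteq> {}" "C2 \<noteq> {}"
    using ne by (auto simp: C1_def C2_def)
  have "(convex hull C1) \<times> (convex hull C2) face_of S \<times> T"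
    using C'(2) by (simp add: eq convex_hull_Times)
  then have faces: "convex hull C1 face_of S" "convex hull C2 face_of T"
    using ne' by (auto simp: face_of_Times_eq)
  have single: "card C1 = 1 \<or> card C2 = 1"
  proof (rule ccontr)
    assume "\<not> ?thesis"
    then obtain a a' b b' where "a \<in> C1" "a' \<in> C1" "a \<noteq> a'" "b \<in> C2" "b' \<in> C2" "b \<noteq> b'"
      using ne' by (metis is_singletonI' is_singleton_altdef)
    then have "affine_dependent C"
      unfolding eq by (rule affine_dependent_Times)
    with C'(1) show False by simp
  qed
  have "\<not> affine_dependent C1 \<and> \<not> affine_dependent C2"
    using single
  proof
    assume "card C1 = 1"
    then obtain a where "C1 = {a}" using card_1_singletonE by blast
    then show ?thesis
      using C'(1) by (simp add: eq affine_dependent_singleton_Times)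
  next
    assume "card C2 = 1"
    then obtain b where "C2 = {b}" using card_1_singletonE by blast
    then show ?thesis
      using C'(1) by (simp add: eq affine_dependent_Times_singleton)
  qed
  then show ?thesis
    using eq single faces unfolding simplex_vertex_sets_def by blast
qed

lemma simplex_vertex_sets_TimesI:
  fixes S :: "'a::euclidean_space set" and T :: "'b::euclidean_space set"
  assumes C1: "C1 \<in> simplex_vertex_sets S" and C2: "C2 \<in> simplex_vertex_sets T"
    and single: "card C1 = 1 \<or> card C2 = 1"
  shows "C1 \<times> C2 \<in> simplex_vertex_sets (S \<times> T)"
proof -
  have "\<not> affine_dependent (C1 \<times> C2)"
    using single
  proof
    assume "card C1 = 1"
    then obtain a where "C1 = {a}" using card_1_singletonE by blast
    then show ?thesis
      using simplex_vertex_setsD(1)[OF C2] by (simp add: affine_dependent_singleton_Times)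
  next
    assume "card C2 = 1"
    then obtain b where "C2 = {b}" using card_1_singletonE by blast
    then show ?thesis
      using simplex_vertex_setsD(1)[OF C1] by (simp add: affine_dependent_Times_singleton)
  qed
  then show ?thesis
    using simplex_vertex_setsD(2)[OF C1] simplex_vertex_setsD(2)[OF C2]
    by (simp add: simplex_vertex_sets_def convex_hull_Times face_of_Times)
qed

text \<open>The cases differ because the families "simplex times vertex" and "vertex times simplex"
  are disjoint for positive \<open>k\<close> and coincide for \<open>k = 0\<close>.\<close>

lemma simplex_face_count_Times:
  fixes S :: "'a::euclidean_space set" and T :: "'b::euclidean_space set"
  assumes S: "polyhedron S" and T: "polyhedron T"
  shows "simplex_face_count k (S \<times> T) =
    (if k = 0 then simplex_face_count 0 S * simplex_face_count 0 T
     else simplex_face_count k S * simplex_face_count 0 T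
        + simplex_face_count 0 S * simplex_face_count k T)"
proof -
  define X where "X k = {C \<in> simplex_vertex_sets S. card C = Suc k}" for k
  define Y where "Y k = {C \<in> simplex_vertex_sets T. card C = Suc k}" for k
  have fin: "finite (X k)" "finite (Y k)" for k
    using finite_simplex_vertex_sets[OF S] finite_simplex_vertex_sets[OF T]
    by (auto simp: X_def Y_def)
  have inj: "inj_on (\<lambda>(C1, C2). C1 \<times> C2) (X k \<times> Y 0 \<union> X 0 \<times> Y k)"
    by (rule inj_onI) (auto simp: X_def Y_def times_eq_iff)
  have "{C \<in> simplex_vertex_sets (S \<times> T). card C = Suc k} =
      (\<lambda>(C1, C2). C1 \<times> C2) ` (X k \<times> Y 0 \<union> X 0 \<times> Y k)" (is "?L = ?R")
  proof
    show "?L \<subseteq> ?R"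
    proof
      fix C assume C: "C \<in> ?L"
      then have "C \<noteq> {}" by auto
      then obtain C1 C2 where "C1 \<in> simplex_vertex_sets S" "C2 \<in> simplex_vertex_sets T"
        "C = C1 \<times> C2" "card C1 = 1 \<or> card C2 = 1"
        using simplex_vertex_sets_TimesD[of C S T] C by auto
      then have "(C1, C2) \<in> X k \<times> Y 0 \<union> X 0 \<times> Y k"
        using C by (auto simp: X_def Y_def card_cartesian_product)
      then show "C \<in> ?R" using \<open>C = C1 \<times> C2\<close> by force
    qed
    show "?R \<subseteq> ?L"
      by (auto simp: X_def Y_def card_cartesian_product intro!: simplex_vertex_sets_TimesI)
  qed
  then have "simplex_face_count k (S \<times> T) = card (X k \<times> Y 0 \<union> X 0 \<times> Y k)"
    by (simp add: simplex_face_count_eq card_image[OF inj])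
  also have "\<dots> = (if k = 0 then card (X 0) * card (Y 0)
      else card (X k) * card (Y 0) + card (X 0) * card (Y k))"
  proof (cases "k = 0")
    case False
    then have "X k \<times> Y 0 \<inter> X 0 \<times> Y k = {}"
      by (auto simp: X_def Y_def)
    then show ?thesis
      using False fin by (simp add: card_Un_disjoint card_cartesian_product)
  qed (simp add: card_cartesian_product)
  finally show ?thesis
    by (simp add: simplex_face_count_eq X_def Y_def)
qed

section \<open>Wedges at a common vertex\<close>

text \<open>The two pieces are kept in separate factors of a product space; addition of the
  components later returns the construction to the ambient space of the poset. The same notation is
  applied to polytopes and to vertex sets.\<close>

abbreviation wedge :: "'a::euclidean_space set \<Rightarrow> 'b::euclidean_space set \<Rightarrow> ('a \<times> 'b) set" where
  "wedge S T \<equiv> S \<times> {0} \<union> {0} \<times> T"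

text \<open>The two normal forms of a supporting hyperplane; sharing the level \<open>c\<close> lets a functional
  on each factor be combined into one on the wedge.\<close>

lemma face_of_polyhedron_normalized:
  fixes S :: "'a::euclidean_space set"
  assumes S: "polyhedron S" "0 \<in> S" and F: "F face_of S"
    and c: "c = (if 0 \<in> F then 0 else (1::real))"
  obtains a where "\<And>x. x \<in> S \<Longrightarrow> a \<bullet> x \<le> c" "F = S \<inter> {x. a \<bullet> x = c}"
proof -
  obtain a b where ab: "S \<subseteq> {x. a \<bullet> x \<le> b}" "F = S \<inter> {x. a \<bullet> x = b}"
    using F exposed_face_of_polyhedron[OF S(1)] unfolding exposed_face_of_def by blast
  have "0 \<le> b" using ab(1) S(2) by auto
  show thesis
  proof (cases "0 \<in> F")
    case True
    then have "b = 0" using ab(2) by auto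
    then show ?thesis using True ab c that[of a] by auto
  next
    case False
    \<comment> \<open>The origin lies in \<open>S\<close> but not on the hyperplane, so its level is
      positive and can be scaled to 1.\<close>
    then have "b > 0" using ab(2) S(2) \<open>0 \<le> b\<close> by (auto simp: less_le)
    then show ?thesis
      using False ab c by (intro that[of "a /\<^sub>R b"]) (auto simp: field_simps)
  qed
qed

lemma convex_hull_wedge:
  fixes S :: "'a::euclidean_space set" and T :: "'b::euclidean_space set"
  assumes S: "convex S" "S \<noteq> {}" and T: "convex T" "T \<noteq> {}"
  shows "convex hull (wedge S T) =
    {(u *\<^sub>R s, v *\<^sub>R t) | u v s t. 0 \<le> u \<and> 0 \<le> v \<and> u + v = 1 \<and> s \<in> S \<and> t \<in> T}"
proof -
  have "convex (S \<times> {0::'b})" "convex ({0::'a} \<times> T)"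
    using S T by (auto intro!: convex_Times)
  then show ?thesis
    using S T by (subst convex_hull_union_two) force+
qed

lemma convex_hull_wedgeI:
  fixes S :: "'a::euclidean_space set" and T :: "'b::euclidean_space set"
  assumes "convex S" "S \<noteq> {}" "convex T" "T \<noteq> {}"
    and "s \<in> S" "t \<in> T" "0 \<le> u" "0 \<le> v" "u + v = 1"
  shows "(u *\<^sub>R s, v *\<^sub>R t) \<in> convex hull (wedge S T)"
  unfolding convex_hull_wedge[OF assms(1-4)] using assms(5-) by blast

text \<open>The functional \<open>(a, b)\<close> supports the hull at level \<open>c\<close>: on a
  point with weights \<open>u\<close>, \<open>v\<close> it is the weighted mean of two values that
  are at most \<open>c\<close>. Equality forces every component of nonzero weight onto its own
  hyperplane.\<close>

lemma convex_hull_wedge_face: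
  fixes S :: "'a::euclidean_space set" and T :: "'b::euclidean_space set"
  assumes S: "convex S" "S \<noteq> {}" and T: "convex T" "T \<noteq> {}"
    and a: "\<And>x. x \<in> S \<Longrightarrow> a \<bullet> x \<le> c" and b: "\<And>y. y \<in> T \<Longrightarrow> b \<bullet> y \<le> c"
  shows "convex hull (wedge (S \<inter> {x. a \<bullet> x = c}) (T \<inter> {y. b \<bullet> y = c})) face_of convex hull (wedge S T)"
proof -
  let ?W = "wedge (S \<inter> {x. a \<bullet> x = c}) (T \<inter> {y. b \<bullet> y = c})"
  note rep = convex_hull_wedge[OF S T]
  have "convex hull ?W = convex hull (wedge S T) \<inter> {z. (a, b) \<bullet> z = c}"
  proof
    show "convex hull ?W \<subseteq> convex hull (wedge S T) \<inter> {z. (a, b) \<bullet> z = c}"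
    proof (rule hull_minimal)
      show "?W \<subseteq> convex hull (wedge S T) \<inter> {z. (a, b) \<bullet> z = c}"
        by (auto intro!: hull_inc)
      show "convex (convex hull (wedge S T) \<inter> {z. (a, b) \<bullet> z = c})"
        by (intro convex_Int convex_convex_hull convex_hyperplane)
    qed
    show "convex hull (wedge S T) \<inter> {z. (a, b) \<bullet> z = c} \<subseteq> convex hull ?W"
    proof
      fix z assume z: "z \<in> convex hull (wedge S T) \<inter> {z. (a, b) \<bullet> z = c}"
      then obtain u v s t where uv: "z = (u *\<^sub>R s, v *\<^sub>R t)" "0 \<le> u" "0 \<le> v" "u + v = 1"
          and st: "s \<in> S" "t \<in> T"
        using rep by auto
      have "u * (a \<bullet> s) + v * (b \<bullet> t) = c"
        using z uv by simp
      then have "u * (c - a \<bullet> s) + v * (c - b \<bullet> t) = (u + v) * c - c"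
        by (simp add: algebra_simps)
      then have "u * (c - a \<bullet> s) + v * (c - b \<bullet> t) = 0"
        using uv by simp
      moreover have "u * (c - a \<bullet> s) \<ge> 0" "v * (c - b \<bullet> t) \<ge> 0"
        using a[OF st(1)] b[OF st(2)] uv by auto
      ultimately have "u * (c - a \<bullet> s) = 0" "v * (c - b \<bullet> t) = 0"
        by linarith+
      then have "u = 0 \<or> (s, 0) \<in> convex hull ?W" "v = 0 \<or> (0, t) \<in> convex hull ?W"
        using st by (auto intro!: hull_inc)
      \<comment> \<open>The weights add up to 1, so they cannot both vanish.\<close>
      then consider "u = 0" "(0, t) \<in> convex hull ?W" | "v = 0" "(s, 0) \<in> convex hull ?W"
        | "(s, 0) \<in> convex hull ?W" "(0, t) \<in> convex hull ?W"
        using uv by fastforce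
      then show "z \<in> convex hull ?W"
      proof cases
        case 3
        then have "u *\<^sub>R (s, 0) + v *\<^sub>R (0, t) \<in> convex hull ?W"
          using uv by (intro convexD[OF convex_convex_hull]) auto
        then show ?thesis using uv by simp
      qed (use uv in auto)
    qed
  qed
  also have "\<dots> face_of convex hull (wedge S T)"
  proof (rule face_of_Int_supporting_hyperplane_le)
    fix z assume "z \<in> convex hull (wedge S T)"
    then obtain u v s t where uv: "z = (u *\<^sub>R s, v *\<^sub>R t)" "0 \<le> u" "0 \<le> v" "u + v = 1"
        and st: "s \<in> S" "t \<in> T"
      using rep by auto
    have "u * (a \<bullet> s) + v * (b \<bullet> t) \<le> u * c + v * c"
      using a[OF st(1)] b[OF st(2)] uv by (intro add_mono mult_left_mono) auto
    also have "\<dots> = c" using uv by (simp flip: distrib_right)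
    finally show "(a, b) \<bullet> z \<le> c" using uv by simp
  qed simp
  finally show ?thesis .
qed

text \<open>In effect \<open>C - {0}\<close> is linearly independent. Off the origin, level 1 of the
  functional forces the coefficients to sum to 0. If the origin is in \<open>C\<close>, its own
  coefficient contributes nothing to the combination and can be chosen to make the sum 0. Either way
  a nonzero coefficient would be an affine dependence.\<close>

lemma vanishing_combination_affine_independent:
  fixes C :: "'a::real_inner set"
  assumes C: "\<not> affine_dependent C" "finite C"
    and a: "\<And>x. x \<in> C \<Longrightarrow> a \<bullet> x = (if 0 \<in> C then 0 else 1)"
    and U: "(\<Sum>x\<in>C. U x *\<^sub>R x) = 0" and x: "x \<in> C" "x \<noteq> 0"
  shows "U x = 0"
proof (rule ccontr)
  assume Ux: "U x \<noteq> 0"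
  show False
  proof (cases "0 \<in> C")
    case False
    have "0 = a \<bullet> (\<Sum>x\<in>C. U x *\<^sub>R x)" by (simp add: U)
    also have "\<dots> = sum U C"
      using a False by (simp add: inner_sum_right)
    finally show False
      using C U x Ux affine_dependent_explicit_finite[OF C(2)] by metis
  next
    case True
    define V where "V = (\<lambda>y. if y = 0 then - sum U (C - {0}) else U y)"
    have "sum V C = 0"
    proof -
      have "sum V (C - {0}) = sum U (C - {0})"
        by (rule sum.cong) (auto simp: V_def)
      then show ?thesis
        using sum.remove[OF C(2) True, of V] by (simp add: V_def)
    qed
    moreover have "(\<Sum>y\<in>C. V y *\<^sub>R y) = 0"
    proof -
      have "(\<Sum>y\<in>C. V y *\<^sub>R y) = (\<Sum>y\<in>C. U y *\<^sub>R y)"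
        by (rule sum.cong) (auto simp: V_def)
      then show ?thesis using U by simp
    qed
    moreover have "V x \<noteq> 0" using Ux x by (simp add: V_def)
    ultimately show False
      using C x affine_dependent_explicit_finite[OF C(2)] by metis
  qed
qed

text \<open>Projecting a dependence to each factor kills the coefficients of all nonzero vertices of
  that factor. What is left sits at the shared origin, whose coefficient then equals the total,
  which is 0.\<close>

lemma affine_independent_wedge:
  fixes C :: "'a::euclidean_space set" and D :: "'b::euclidean_space set"
  assumes C: "\<not> affine_dependent C" "finite C" and D: "\<not> affine_dependent D" "finite D"
    and zero: "0 \<in> C \<longleftrightarrow> 0 \<in> D"
    and a: "\<And>x. x \<in> C \<Longrightarrow> a \<bullet> x = (if 0 \<in> C then 0 else 1)"
    and b: "\<And>y. y \<in> D \<Longrightarrow> b \<bullet> y = (if 0 \<in> D then 0 else 1)"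
  shows "\<not> affine_dependent (wedge C D)"
proof
  assume dep: "affine_dependent (wedge C D)"
  have fin: "finite (wedge C D)" using C D by auto
  obtain U w where U: "sum U (wedge C D) = 0" "w \<in> wedge C D" "U w \<noteq> 0"
      "(\<Sum>w\<in>wedge C D. U w *\<^sub>R w) = 0"
    using dep affine_dependent_explicit_finite[OF fin] by blast
  have "0 = fst (\<Sum>w\<in>wedge C D. U w *\<^sub>R w)" by (simp add: U)
  also have "\<dots> = (\<Sum>w\<in>wedge C D. U w *\<^sub>R fst w)" by (simp add: fst_sum)
  also have "\<dots> = (\<Sum>w\<in>C \<times> {0}. U w *\<^sub>R fst w)"
    by (rule sum.mono_neutral_right) (use fin in auto)
  also have "\<dots> = (\<Sum>x\<in>C. U (x, 0) *\<^sub>R x)"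
    by (rule sum.reindex_bij_witness[where i = "\<lambda>x. (x, 0)" and j = fst]) auto
  finally have "(\<Sum>x\<in>C. U (x, 0) *\<^sub>R x) = 0" by simp
  then have 1: "U (x, 0) = 0" if "x \<in> C" "x \<noteq> 0" for x
    using vanishing_combination_affine_independent[where a = a and U = "\<lambda>x. U (x, 0)", OF C a] that
    by blast
  have "0 = snd (\<Sum>w\<in>wedge C D. U w *\<^sub>R w)" by (simp add: U)
  also have "\<dots> = (\<Sum>w\<in>wedge C D. U w *\<^sub>R snd w)" by (simp add: snd_sum)
  also have "\<dots> = (\<Sum>w\<in>{0} \<times> D. U w *\<^sub>R snd w)"
    by (rule sum.mono_neutral_right) (use fin in auto)
  also have "\<dots> = (\<Sum>y\<in>D. U (0, y) *\<^sub>R y)"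
    by (rule sum.reindex_bij_witness[where i = "\<lambda>y. (0, y)" and j = snd]) auto
  finally have "(\<Sum>y\<in>D. U (0, y) *\<^sub>R y) = 0" by simp
  then have 2: "U (0, y) = 0" if "y \<in> D" "y \<noteq> 0" for y
    using vanishing_combination_affine_independent[where a = b and U = "\<lambda>y. U (0, y)", OF D b] that
    by blast
  have off: "U v = 0" if "v \<in> wedge C D" "v \<noteq> 0" for v
    using that 1 2 by (auto simp: zero_prod_def)
  then have "w = 0" using U by blast
  moreover have "sum U (wedge C D) = sum U {0}"
    using off \<open>w = 0\<close> U(2) fin by (intro sum.mono_neutral_right) auto
  ultimately show False using U by simp
qed

lemma extreme_point_of_imp_mem: "x extreme_point_of S \<Longrightarrow> x \<in> S"
  by (simp add: extreme_point_of_def)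

lemma zero_in_convex_hull_iff:
  assumes "C \<in> simplex_vertex_sets S" "0 extreme_point_of S"
  shows "0 \<in> convex hull C \<longleftrightarrow> 0 \<in> C"
  using mem_simplex_vertex_set_iff[OF assms(1)] assms(2) by blast

lemma convex_hull_wedge_convex_hull:
  fixes C :: "'a::euclidean_space set" and D :: "'b::euclidean_space set"
  shows "convex hull (wedge (convex hull C) (convex hull D)) = convex hull (wedge C D)"
proof -
  have "(convex hull C) \<times> {0::'b} = convex hull (C \<times> {0})" "{0::'a} \<times> (convex hull D) = convex hull ({0} \<times> D)"
    by (simp_all add: convex_hull_Times)
  moreover have "convex hull (convex hull P \<union> convex hull Q) = convex hull (P \<union> Q)"
    for P Q :: "('a \<times> 'b) set"
  proof
    show "convex hull (convex hull P \<union> convex hull Q) \<subseteq> convex hull (P \<union> Q)"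
      by (rule hull_minimal) (auto intro: hull_mono[THEN subsetD])
    show "convex hull (P \<union> Q) \<subseteq> convex hull (convex hull P \<union> convex hull Q)"
      by (rule hull_mono) (use hull_subset in fast)
  qed
  ultimately show ?thesis by simp
qed

text \<open>The condition \<open>zero\<close> puts both supporting hyperplanes at the same level
  \<open>c\<close>, which is what combining them requires. The same functionals serve for affine
  independence.\<close>

lemma simplex_vertex_sets_wedgeI:
  fixes S :: "'a::euclidean_space set" and T :: "'b::euclidean_space set"
  assumes S: "polyhedron S" "0 extreme_point_of S" and T: "polyhedron T" "0 extreme_point_of T"
    and C: "C \<in> simplex_vertex_sets S" and D: "D \<in> simplex_vertex_sets T"
    and zero: "0 \<in> C \<longleftrightarrow> 0 \<in> D"
  shows "wedge C D \<in> simplex_vertex_sets (convex hull (wedge S T))"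
proof -
  have 0: "0 \<in> S" "0 \<in> T"
    using S T by (simp_all add: extreme_point_of_imp_mem)
  define c where "c = (if 0 \<in> C then 0 else (1::real))"
  have c: "c = (if 0 \<in> convex hull C then 0 else 1)" "c = (if 0 \<in> convex hull D then 0 else 1)"
    using zero_in_convex_hull_iff[OF C S(2)] zero_in_convex_hull_iff[OF D T(2)] zero
    by (auto simp: c_def)
  obtain a where a: "\<And>x. x \<in> S \<Longrightarrow> a \<bullet> x \<le> c" "convex hull C = S \<inter> {x. a \<bullet> x = c}"
    using face_of_polyhedron_normalized[OF S(1) 0(1) simplex_vertex_setsD(2)[OF C] c(1)] by blast
  obtain b where b: "\<And>x. x \<in> T \<Longrightarrow> b \<bullet> x \<le> c" "convex hull D = T \<inter> {x. b \<bullet> x = c}"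
    using face_of_polyhedron_normalized[OF T(1) 0(2) simplex_vertex_setsD(2)[OF D] c(2)] by blast
  have "convex hull (wedge C D) face_of convex hull (wedge S T)"
    using convex_hull_wedge_face[of S T a c b] a b 0 S T polyhedron_imp_convex
    by (metis convex_hull_wedge_convex_hull empty_iff)
  moreover have "\<not> affine_dependent (wedge C D)"
  proof (rule affine_independent_wedge)
    show "a \<bullet> x = (if 0 \<in> C then 0 else 1)" if "x \<in> C" for x
      using hull_inc[OF that, of convex] a(2) by (auto simp: c_def)
    show "b \<bullet> x = (if 0 \<in> D then 0 else 1)" if "x \<in> D" for x
      using hull_inc[OF that, of convex] b(2) zero by (auto simp: c_def)
  qed (use simplex_vertex_setsD[OF C] simplex_vertex_setsD[OF D] zero in auto)
  ultimately show ?thesis by (simp add: simplex_vertex_sets_def)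
qed

text \<open>Vertices of a convex hull belong to the generating set, so \<open>W\<close> splits into
  its two slices. Each slice is a subset of \<open>W\<close> and hence spans a face of the hull;
  that face lies inside a copy of \<open>S\<close> or \<open>T\<close> and is a face of it.\<close>

lemma simplex_vertex_sets_wedgeD:
  fixes S :: "'a::euclidean_space set" and T :: "'b::euclidean_space set"
  assumes W: "W \<in> simplex_vertex_sets (convex hull (wedge S T))"
    and S: "convex S" "0 \<in> S" and T: "convex T" "0 \<in> T"
  shows "{x. (x, 0) \<in> W} \<in> simplex_vertex_sets S" (is "?C \<in> _")
    and "{y. (0, y) \<in> W} \<in> simplex_vertex_sets T" (is "?D \<in> _")
    and "W = wedge {x. (x, 0) \<in> W} {y. (0, y) \<in> W}"
proof -
  have W': "W \<subseteq> wedge S T"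
    using mem_simplex_vertex_set_iff[OF W] extreme_point_of_convex_hull by blast
  then show "W = wedge ?C ?D" by auto
  have sub: "?C \<subseteq> S" "?D \<subseteq> T"
    using W' S T by auto
  have hull: "convex hull ?C \<subseteq> S" "convex hull ?D \<subseteq> T"
    using sub S T by (simp_all add: subset_hull)
  show "?C \<in> simplex_vertex_sets S"
  proof -
    have *: "?C \<times> {0} \<in> simplex_vertex_sets (convex hull (wedge S T))"
      by (rule simplex_vertex_sets_subset[OF W]) auto
    have "(convex hull ?C) \<times> {0} face_of convex hull (wedge S T)"
      using simplex_vertex_setsD(2)[OF *] by (simp add: convex_hull_Times)
    then have "(convex hull ?C) \<times> {0::'b} face_of S \<times> {0}"
      by (rule face_of_subset) (use hull(1) hull_subset in fast)+
    then have "convex hull ?C face_of S"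
      by (auto simp: face_of_Times_eq)
    then show ?thesis
      using simplex_vertex_setsD(1)[OF *]
      by (simp add: simplex_vertex_sets_def affine_dependent_Times_singleton)
  qed
  show "?D \<in> simplex_vertex_sets T"
  proof -
    have *: "{0} \<times> ?D \<in> simplex_vertex_sets (convex hull (wedge S T))"
      by (rule simplex_vertex_sets_subset[OF W]) auto
    have "{0} \<times> (convex hull ?D) face_of convex hull (wedge S T)"
      using simplex_vertex_setsD(2)[OF *] by (simp add: convex_hull_Times)
    then have "{0::'a} \<times> (convex hull ?D) face_of {0} \<times> T"
      by (rule face_of_subset) (use hull(2) hull_subset in fast)+
    then have "convex hull ?D face_of T"
      by (auto simp: face_of_Times_eq)
    then show ?thesis
      using simplex_vertex_setsD(1)[OF *]
      by (simp add: simplex_vertex_sets_def affine_dependent_singleton_Times)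
  qed
qed

text \<open>The correction term is the shared origin, counted once in each factor.\<close>

lemma card_wedge:
  fixes C :: "'a::euclidean_space set" and D :: "'b::euclidean_space set"
  assumes "finite C" "finite D" "0 \<in> C \<longleftrightarrow> 0 \<in> D"
  shows "card (wedge C D) + of_bool (0 \<in> C) = card C + card D"
proof -
  have "card (C \<times> {0::'b}) + card ({0::'a} \<times> D) = card (wedge C D) + card (C \<times> {0::'b} \<inter> {0} \<times> D)"
    using assms by (intro card_Un_Int) auto
  moreover have "C \<times> {0::'b} \<inter> {0} \<times> D = (if 0 \<in> C then {0} else {})"
    using assms(3) by (auto simp: zero_prod_def)
  ultimately show ?thesis
    by (simp add: card_cartesian_product split: if_splits)
qed

text \<open>The flag \<open>z\<close> tells whether the origin is a vertex, so that one argument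
  yields both convolutions. A vertex set of the wedge corresponds to the pair of its slices, which
  agree about the origin, and \<open>i\<close> is the number of nonzero vertices of the first
  slice.\<close>

lemma card_simplex_vertex_sets_wedge:
  fixes S :: "'a::euclidean_space set" and T :: "'b::euclidean_space set" and z :: bool
  assumes S: "polyhedron S" "0 extreme_point_of S" and T: "polyhedron T" "0 extreme_point_of T"
  shows "card {W \<in> simplex_vertex_sets (convex hull (wedge S T)). (0 \<in> W) = z \<and> card W = n + of_bool z}
    = (\<Sum>i\<le>n. card {C \<in> simplex_vertex_sets S. (0 \<in> C) = z \<and> card C = i + of_bool z}
             * card {D \<in> simplex_vertex_sets T. (0 \<in> D) = z \<and> card D = n - i + of_bool z})"
proof -
  let ?X = "\<lambda>i. {C \<in> simplex_vertex_sets S. (0 \<in> C) = z \<and> card C = i + of_bool z}"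
  let ?Y = "\<lambda>i. {D \<in> simplex_vertex_sets T. (0 \<in> D) = z \<and> card D = i + of_bool z}"
  let ?Z = "{W \<in> simplex_vertex_sets (convex hull (wedge S T)). (0 \<in> W) = z \<and> card W = n + of_bool z}"
  have 0: "convex S" "convex T" "0 \<in> S" "0 \<in> T"
    using S T by (simp_all add: polyhedron_imp_convex extreme_point_of_imp_mem)
  have fin: "finite (?X i)" "finite (?Y i)" for i
    using finite_simplex_vertex_sets[OF S(1)] finite_simplex_vertex_sets[OF T(1)] by simp_all
  have "bij_betw (\<lambda>(i, C, D). wedge C D) (SIGMA i:{..n}. ?X i \<times> ?Y (n - i)) ?Z"
  proof (rule bij_betw_byWitness[where f' = "\<lambda>W. (card {x. (x, 0) \<in> W} - of_bool z,
        {x. (x, 0) \<in> W}, {y. (0, y) \<in> W})"])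
    show "\<forall>p\<in>SIGMA i:{..n}. ?X i \<times> ?Y (n - i).
        (\<lambda>W. (card {x. (x, 0) \<in> W} - of_bool z, {x. (x, 0) \<in> W}, {y. (0, y) \<in> W}))
          ((\<lambda>(i, C, D). wedge C D) p) = p"
    proof
      fix p assume "p \<in> (SIGMA i:{..n}. ?X i \<times> ?Y (n - i))"
      then obtain i C D where p: "p = (i, C, D)" and z: "(0 \<in> C) = z" "(0 \<in> D) = z"
          and card: "card C = i + of_bool z"
        by (cases p) simp
      have "{x. (x, 0) \<in> wedge C D} = C" "{y. (0, y) \<in> wedge C D} = D"
        using z by auto
      then show "(\<lambda>W. (card {x. (x, 0) \<in> W} - of_bool z, {x. (x, 0) \<in> W}, {y. (0, y) \<in> W}))
          ((\<lambda>(i, C, D). wedge C D) p) = p"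
        using card p by simp
    qed
    show "\<forall>W\<in>?Z. (\<lambda>(i, C, D). wedge C D)
        (card {x. (x, 0) \<in> W} - of_bool z, {x. (x, 0) \<in> W}, {y. (0, y) \<in> W}) = W"
      using simplex_vertex_sets_wedgeD(3)[OF _ 0(1,3,2,4)] by simp
    show "(\<lambda>(i, C, D). wedge C D) ` (SIGMA i:{..n}. ?X i \<times> ?Y (n - i)) \<subseteq> ?Z"
    proof (rule image_subsetI)
      fix p assume "p \<in> (SIGMA i:{..n}. ?X i \<times> ?Y (n - i))"
      then obtain i C D where p: "p = (i, C, D)" and i: "i \<le> n"
          and C: "C \<in> simplex_vertex_sets S" and D: "D \<in> simplex_vertex_sets T"
          and z: "(0 \<in> C) = z" "(0 \<in> D) = z"
          and card: "card C = i + of_bool z" "card D = n - i + of_bool z"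
        by (cases p) simp
      have "card (wedge C D) = n + of_bool z"
        using card_wedge[of C D] simplex_vertex_setsD(3)[OF C] simplex_vertex_setsD(3)[OF D] card z i
        by simp
      moreover have "(0 \<in> wedge C D) = z"
        using z by (simp add: zero_prod_def)
      ultimately show "(\<lambda>(i, C, D). wedge C D) p \<in> ?Z"
        using simplex_vertex_sets_wedgeI[OF S T C D] z p by simp
    qed
    show "(\<lambda>W. (card {x. (x, 0) \<in> W} - of_bool z, {x. (x, 0) \<in> W}, {y. (0, y) \<in> W})) ` ?Z
        \<subseteq> (SIGMA i:{..n}. ?X i \<times> ?Y (n - i))"
    proof (rule image_subsetI)
      fix W assume "W \<in> ?Z"
      then have W: "W \<in> simplex_vertex_sets (convex hull (wedge S T))"
          and zW: "(0 \<in> W) = z" and cW: "card W = n + of_bool z"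
        by auto
      define C D where "C = {x. (x, 0) \<in> W}" and "D = {y. (0, y) \<in> W}"
      have CD: "C \<in> simplex_vertex_sets S" "D \<in> simplex_vertex_sets T" "W = wedge C D"
        using simplex_vertex_sets_wedgeD[OF W 0(1,3,2,4)] by (auto simp: C_def D_def)
      have z: "(0 \<in> C) = z" "(0 \<in> D) = z"
        using zW by (auto simp: C_def D_def zero_prod_def)
      have "n + of_bool z + of_bool z = card C + card D"
        using card_wedge[of C D] simplex_vertex_setsD(3)[OF CD(1)] simplex_vertex_setsD(3)[OF CD(2)]
          z cW by (simp flip: CD(3))
      \<comment> \<open>A slice containing the origin has at least one element, so the truncated
        subtraction below is exact.\<close>
      moreover have "of_bool z \<le> card C" "of_bool z \<le> card D"
        using z simplex_vertex_setsD(3)[OF CD(1)] simplex_vertex_setsD(3)[OF CD(2)]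
        by (auto simp: of_bool_def Suc_le_eq card_gt_0_iff)
      ultimately have "(card C - of_bool z, C, D) \<in> (SIGMA i:{..n}. ?X i \<times> ?Y (n - i))"
        using CD z by auto
      then show "(card {x. (x, 0) \<in> W} - of_bool z, {x. (x, 0) \<in> W}, {y. (0, y) \<in> W})
          \<in> (SIGMA i:{..n}. ?X i \<times> ?Y (n - i))"
        by (simp add: C_def D_def)
    qed
  qed
  then have "card ?Z = card (SIGMA i:{..n}. ?X i \<times> ?Y (n - i))"
    by (rule bij_betw_same_card[symmetric])
  also have "\<dots> = (\<Sum>i\<le>n. card (?X i \<times> ?Y (n - i)))"
    by (rule card_SigmaI) (use fin in \<open>blast intro: finite_cartesian_product\<close>)+
  finally show ?thesis
    by (simp only: card_cartesian_product)
qed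

lemma simplex_face_count_wedge:
  fixes S :: "'a::euclidean_space set" and T :: "'b::euclidean_space set"
  assumes S: "polyhedron S" "0 extreme_point_of S" and T: "polyhedron T" "0 extreme_point_of T"
  shows "simplex_face_count k (convex hull (wedge S T)) =
      (\<Sum>i\<le>k. faces_at_origin i S * faces_at_origin (k - i) T)
    + (\<Sum>i\<le>Suc k. faces_off_origin i S * faces_off_origin (Suc k - i) T)"
proof -
  have 0: "convex S" "convex T" "0 \<in> S" "0 \<in> T"
    using S T by (simp_all add: polyhedron_imp_convex extreme_point_of_imp_mem)
  let ?J = "simplex_vertex_sets (convex hull (wedge S T))"
  \<comment> \<open>Finiteness is read off from the decomposition into slices, without describing
    the hull by inequalities.\<close>
  have "finite ?J"
  proof (rule finite_subset)
    show "?J \<subseteq> (\<lambda>(C, D). wedge C D) ` (simplex_vertex_sets S \<times> simplex_vertex_sets T)"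
    proof
      fix W assume W: "W \<in> ?J"
      note * = simplex_vertex_sets_wedgeD[OF W 0(1,3,2,4)]
      show "W \<in> (\<lambda>(C, D). wedge C D) ` (simplex_vertex_sets S \<times> simplex_vertex_sets T)"
        by (rule image_eqI[of _ _ "({x. (x, 0) \<in> W}, {y. (0, y) \<in> W})"]) (use * in simp_all)
    qed
    show "finite ((\<lambda>(C, D). wedge C D) ` (simplex_vertex_sets S \<times> simplex_vertex_sets T))"
      using finite_simplex_vertex_sets[OF S(1)] finite_simplex_vertex_sets[OF T(1)] by simp
  qed
  then show ?thesis
    using card_simplex_vertex_sets_wedge[OF S T, of True k]
      card_simplex_vertex_sets_wedge[OF S T, of False "Suc k"]
    by (simp add: simplex_face_count_split faces_at_origin_def faces_off_origin_def)
qed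

text \<open>With \<open>p\<close>, \<open>q\<close> counting simplex faces through and off the glued vertex, the count for a wedge
  increases with the total and decreases with the part through the vertex, as long as \<open>p i \<le> q i\<close>.\<close>

lemma wedge_convolution_mono:
  fixes p q p' q' u v u' v' :: "nat \<Rightarrow> nat"
  assumes 0: "q 0 = v 0" "q' 0 = v' 0"
    and total: "\<And>i. p i + q (Suc i) \<le> u i + v (Suc i)" "\<And>i. p' i + q' (Suc i) \<le> u' i + v' (Suc i)"
    and le: "\<And>i. u i \<le> p i" "\<And>i. u' i \<le> p' i" "\<And>i. p' i \<le> q' i" "\<And>i. u i \<le> v i"
  shows "(\<Sum>i\<le>k. p i * p' (k - i)) + (\<Sum>i\<le>Suc k. q i * q' (Suc k - i))
       \<le> (\<Sum>i\<le>k. u i * u' (k - i)) + (\<Sum>i\<le>Suc k. v i * v' (Suc k - i))"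
proof -
  \<comment> \<open>The argument works with differences, hence the passage to integers.\<close>
  define P Q P' Q' U V U' V' :: "nat \<Rightarrow> int"
    where "P = int \<circ> p" and "Q = int \<circ> q" and "P' = int \<circ> p'" and "Q' = int \<circ> q'"
      and "U = int \<circ> u" and "V = int \<circ> v" and "U' = int \<circ> u'" and "V' = int \<circ> v'"
  note defs = P_def Q_def P'_def Q'_def U_def V_def U'_def V'_def
  have nonneg: "0 \<le> P' i" "0 \<le> U i" for i by (simp_all add: defs)
  have le': "U i \<le> P i" "U' i \<le> P' i" "P' i \<le> Q' i" "U i \<le> V i" for i
    using le[of i] by (simp_all add: defs)
  have total': "P i - U i \<le> V (Suc i) - Q (Suc i)" "P' i - U' i \<le> V' (Suc i) - Q' (Suc i)" for i
    using total[of i] by (simp_all add: defs algebra_simps flip: of_nat_add)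
  have nonneg': "0 \<le> V (Suc i) - Q (Suc i)" "0 \<le> P' i - U' i" "0 \<le> V i" for i
    using le'(1,2)[of i] total'(1)[of i] by (simp_all add: defs)
  \<comment> \<open>Exchange of the first factor. The surplus of \<open>P\<close> over
    \<open>U\<close> in degree \<open>i\<close> is covered by the surplus of \<open>V\<close> over
    \<open>Q\<close> in degree \<open>Suc i\<close>, and the weight grows from \<open>P'\<close> to
    \<open>Q'\<close>. The additional term for \<open>i = 0\<close> vanishes because
    \<open>q 0 = v 0\<close>.\<close>
  have A: "(\<Sum>i\<le>k. (P i - U i) * P' (k - i)) \<le> (\<Sum>i\<le>Suc k. (V i - Q i) * Q' (Suc k - i))"
  proof -
    have "(\<Sum>i\<le>k. (P i - U i) * P' (k - i)) \<le> (\<Sum>i\<le>k. (V (Suc i) - Q (Suc i)) * Q' (k - i))"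
      by (intro sum_mono mult_mono le' total' nonneg nonneg')
    also have "\<dots> = (\<Sum>i\<le>Suc k. (V i - Q i) * Q' (Suc k - i))"
      by (subst sum.atMost_Suc_shift) (simp add: 0 defs)
    finally show ?thesis .
  qed
  \<comment> \<open>Exchange of the second factor, now weighted by \<open>U <= V\<close>. Here the
    additional term is the last one, which vanishes because \<open>q' 0 = v' 0\<close>.\<close>
  have B: "(\<Sum>i\<le>k. U i * (P' (k - i) - U' (k - i)))
      \<le> (\<Sum>i\<le>Suc k. V i * (V' (Suc k - i) - Q' (Suc k - i)))"
  proof -
    have "(\<Sum>i\<le>k. U i * (P' (k - i) - U' (k - i)))
        \<le> (\<Sum>i\<le>k. V i * (V' (Suc (k - i)) - Q' (Suc (k - i))))"
      by (intro sum_mono mult_mono le' total' nonneg nonneg')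
    also have "\<dots> = (\<Sum>i\<le>Suc k. V i * (V' (Suc k - i) - Q' (Suc k - i)))"
      by (simp add: 0 defs Suc_diff_le)
    finally show ?thesis .
  qed
  \<comment> \<open>Telescoping: P P' - U U' = (P - U) P' + U (P' - U'), and likewise V V' - Q Q' =
    (V - Q) Q' + V (V' - Q').\<close>
  have "(\<Sum>i\<le>k. P i * P' (k - i)) - (\<Sum>i\<le>k. U i * U' (k - i))
      = (\<Sum>i\<le>k. (P i - U i) * P' (k - i)) + (\<Sum>i\<le>k. U i * (P' (k - i) - U' (k - i)))"
    by (simp add: algebra_simps flip: sum.distrib sum_subtractf)
  also have "\<dots> \<le> (\<Sum>i\<le>Suc k. (V i - Q i) * Q' (Suc k - i))
      + (\<Sum>i\<le>Suc k. V i * (V' (Suc k - i) - Q' (Suc k - i)))"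
    using A B by (rule add_mono)
  also have "\<dots> = (\<Sum>i\<le>Suc k. V i * V' (Suc k - i)) - (\<Sum>i\<le>Suc k. Q i * Q' (Suc k - i))"
    unfolding sum.distrib[symmetric] sum_subtractf[symmetric]
    by (rule sum.cong) (auto simp: algebra_simps)
  finally have "(\<Sum>i\<le>k. P i * P' (k - i)) + (\<Sum>i\<le>Suc k. Q i * Q' (Suc k - i))
      \<le> (\<Sum>i\<le>k. U i * U' (k - i)) + (\<Sum>i\<le>Suc k. V i * V' (Suc k - i))"
    by linarith
  then have "int ((\<Sum>i\<le>k. p i * p' (k - i)) + (\<Sum>i\<le>Suc k. q i * q' (Suc k - i)))
      \<le> int ((\<Sum>i\<le>k. u i * u' (k - i)) + (\<Sum>i\<le>Suc k. v i * v' (Suc k - i)))"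
    unfolding defs comp_def of_nat_add of_nat_sum of_nat_mult .
  then show ?thesis by linarith
qed

section \<open>Chains in finite posets\<close>

lemma Chains_converse [simp]: "Chains (r\<inverse>) = Chains r"
  by (auto simp: Chains_def)

lemma Chains_subset: "K \<in> Chains r \<Longrightarrow> L \<subseteq> K \<Longrightarrow> L \<in> Chains r"
  by (auto simp: Chains_def)

lemma finite_chain_has_max:
  assumes "finite K" "K \<noteq> {}" "K \<in> Chains r" "trans r"
  shows "\<exists>m\<in>K. \<forall>q\<in>K. (q, m) \<in> r"
  using assms
proof (induction K rule: finite_ne_induct)
  case (singleton x)
  then show ?case by (auto simp: Chains_def)
next
  case (insert x K)
  then obtain m where m: "m \<in> K" "\<forall>q\<in>K. (q, m) \<in> r"
    using Chains_subset[of "insert x K" r K] by blast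
  show ?case
  proof (cases "(x, m) \<in> r")
    case True
    then show ?thesis using m by auto
  next
    case False
    then have "(m, x) \<in> r" "(x, x) \<in> r"
      using insert.prems m by (auto simp: Chains_def)
    then show ?thesis
      using m transD[OF \<open>trans r\<close>] by blast
  qed
qed

lemma partial_order_onD:
  assumes "partial_order_on A r"
  shows "r \<subseteq> A \<times> A" "\<And>p. p \<in> A \<Longrightarrow> (p, p) \<in> r" "trans r" "antisym r"
  using assms by (auto simp: partial_order_on_def preorder_on_def refl_on_def)

lemma Chains_partial_order_subset:
  assumes "partial_order_on A r" "K \<in> Chains r"
  shows "K \<subseteq> A"
  using partial_order_onD(1)[OF assms(1)] assms(2) by (auto simp: Chains_def)

lemma Chains_partial_orderI:
  assumes "partial_order_on A r" "K \<subseteq> A"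
    and "\<And>p q. p \<in> K \<Longrightarrow> q \<in> K \<Longrightarrow> p \<noteq> q \<Longrightarrow> (p, q) \<in> r \<or> (q, p) \<in> r"
  shows "K \<in> Chains r"
  using assms partial_order_onD(2)[OF assms(1)] unfolding Chains_def by blast

lemma chain_sorted_list:
  assumes "finite K" "K \<in> Chains r" "trans r" "antisym r"
  shows "\<exists>ps. set ps = K \<and> sorted_wrt (\<lambda>p q. (p, q) \<in> r \<and> p \<noteq> q) ps"
  using assms(1,2)
proof (induction K rule: finite_psubset_induct)
  case (psubset K)
  show ?case
  proof (cases "K = {}")
    case False
    then obtain m where m: "m \<in> K" "\<forall>q\<in>K. (q, m) \<in> r"
      using finite_chain_has_max[OF psubset.hyps False psubset.prems assms(3)] by blast
    have "K - {m} \<subset> K" using m by auto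
    then obtain ps where "set ps = K - {m}" "sorted_wrt (\<lambda>p q. (p, q) \<in> r \<and> p \<noteq> q) ps"
      using psubset.IH[OF _ Chains_subset[OF psubset.prems Diff_subset]] by blast
    then show ?thesis
      using m by (intro exI[of _ "ps @ [m]"]) (auto simp: sorted_wrt_append)
  qed auto
qed

lemma sorted_list_chain:
  assumes "sorted_wrt (\<lambda>p q. (p, q) \<in> r \<and> p \<noteq> q) ps" "\<And>p. p \<in> set ps \<Longrightarrow> (p, p) \<in> r"
  shows "distinct ps" "set ps \<in> Chains r"
  using assms by (induction ps) (auto simp: Chains_def)

text \<open>A coordinate of Stanley's transfer map from the order to the chain polytope: the rise of
  \<open>f\<close> at \<open>p\<close> over everything strictly below. The inserted 0 is the base
  value at minimal elements.\<close>

definition increment :: "'a rel \<Rightarrow> 'a set \<Rightarrow> ('a \<Rightarrow> real) \<Rightarrow> 'a \<Rightarrow> real" where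
  "increment r A f p = f p - Max (insert 0 (f ` {q \<in> A. (q, p) \<in> r \<and> q \<noteq> p}))"

lemma increment_nonneg:
  assumes "finite A" "0 \<le> f p" "\<And>q. q \<in> A \<Longrightarrow> (q, p) \<in> r \<Longrightarrow> f q \<le> f p"
  shows "0 \<le> increment r A f p"
  using assms by (auto simp: increment_def)

text \<open>When the elements below \<open>p\<close> form a chain, the maximum in
  \<open>increment\<close> is attained at the immediate predecessor, and the sum of the increments
  telescopes.\<close>

lemma sum_increments:
  assumes fin: "finite A" and refl: "\<And>p. p \<in> A \<Longrightarrow> (p, p) \<in> r" and tr: "trans r" "antisym r"
    and f: "\<And>p. p \<in> A \<Longrightarrow> 0 \<le> f p" "\<And>p q. p \<in> A \<Longrightarrow> q \<in> A \<Longrightarrow> (p, q) \<in> r \<Longrightarrow> f p \<le> f q"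
    and p: "p \<in> A" "{q \<in> A. (q, p) \<in> r} \<in> Chains r"
  shows "(\<Sum>q | q \<in> A \<and> (q, p) \<in> r. increment r A f q) = f p"
  using p
proof (induction "card {q \<in> A. (q, p) \<in> r}" arbitrary: p rule: less_induct)
  case less
  let ?S = "{q \<in> A. (q, p) \<in> r \<and> q \<noteq> p}"
  have split: "{q. q \<in> A \<and> (q, p) \<in> r} = insert p ?S"
    using less.prems refl by auto
  have eq: "(\<Sum>q | q \<in> A \<and> (q, p) \<in> r. increment r A f q)
      = increment r A f p + (\<Sum>q\<in>?S. increment r A f q)"
    unfolding split by (rule sum.insert) (use fin in auto)
  show ?case
  proof (cases "?S = {}")
    case True
    show ?thesis
      unfolding eq increment_def True by simp
  next
    case False
    have "?S \<in> Chains r"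
      using less.prems(2) by (rule Chains_subset) auto
    then obtain m where m: "m \<in> ?S" "\<forall>q\<in>?S. (q, m) \<in> r"
      using finite_chain_has_max[OF _ False _ tr(1)] fin by auto
    \<comment> \<open>The elements strictly below \<open>p\<close> are the principal ideal of their
      maximum, to which the induction hypothesis applies.\<close>
    have S: "?S = {q. q \<in> A \<and> (q, m) \<in> r}"
    proof
      show "?S \<subseteq> {q. q \<in> A \<and> (q, m) \<in> r}" using m by auto
      show "{q. q \<in> A \<and> (q, m) \<in> r} \<subseteq> ?S"
        using m transD[OF tr(1)] antisymD[OF tr(2)] by blast
    qed
    have "{q \<in> A. (q, m) \<in> r} \<subset> {q \<in> A. (q, p) \<in> r}"
      using S split by auto
    then have "card {q \<in> A. (q, m) \<in> r} < card {q \<in> A. (q, p) \<in> r}"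
      using fin by (intro psubset_card_mono) auto
    moreover have "{q \<in> A. (q, m) \<in> r} \<in> Chains r"
      using \<open>?S \<in> Chains r\<close> S by simp
    ultimately have "(\<Sum>q | q \<in> A \<and> (q, m) \<in> r. increment r A f q) = f m"
      using less.hyps[of m] m by auto
    moreover have "Max (insert 0 (f ` ?S)) = f m"
      using m f fin by (intro Max_eqI) auto
    ultimately show ?thesis
      unfolding eq S by (simp add: increment_def S)
  qed
qed

text \<open>Triangularity: the sum at \<open>p\<close> is \<open>y p\<close> plus values at strictly
  smaller elements, which vanish by induction. It gives both the independence of filter indicators
  and the injectivity of the inverse transfer map.\<close>

lemma vanishing_if_downset_sums_vanish:
  assumes fin: "finite A" and refl: "\<And>p. p \<in> A \<Longrightarrow> (p, p) \<in> r" and tr: "trans r" "antisym r"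
    and B: "B \<subseteq> A" "\<And>p q. q \<in> B \<Longrightarrow> p \<in> A \<Longrightarrow> (p, q) \<in> r \<Longrightarrow> p \<in> B"
    and y: "\<And>p. p \<in> B \<Longrightarrow> (\<Sum>q | q \<in> A \<and> (q, p) \<in> r. y q) = (0::real)"
    and p: "p \<in> B"
  shows "y p = 0"
  using p
proof (induction "card {q \<in> A. (q, p) \<in> r}" arbitrary: p rule: less_induct)
  case less
  let ?S = "{q \<in> A. (q, p) \<in> r \<and> q \<noteq> p}"
  have split: "{q. q \<in> A \<and> (q, p) \<in> r} = insert p ?S"
    using less.prems refl B(1) by auto
  have "y q = 0" if "q \<in> ?S" for q
  proof (rule less.hyps)
    show "q \<in> B" using that B(2) less.prems by auto
    have "{q' \<in> A. (q', q) \<in> r} \<subseteq> {q \<in> A. (q, p) \<in> r}"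
      using that transD[OF tr(1)] by blast
    moreover have "p \<notin> {q' \<in> A. (q', q) \<in> r}" "p \<in> {q \<in> A. (q, p) \<in> r}"
      using that antisymD[OF tr(2)] split by auto
    ultimately show "card {q' \<in> A. (q', q) \<in> r} < card {q \<in> A. (q, p) \<in> r}"
      using fin by (intro psubset_card_mono) auto
  qed
  then have "(\<Sum>q\<in>?S. y q) = 0" by simp
  moreover have "(\<Sum>q | q \<in> A \<and> (q, p) \<in> r. y q) = y p + (\<Sum>q\<in>?S. y q)"
    unfolding split by (rule sum.insert) (use fin in auto)
  ultimately show ?case using y[OF less.prems] by simp
qed

section \<open>Order and chain polytopes\<close>

definition indicator_vec :: "'n::finite set \<Rightarrow> real ^ 'n" where
  "indicator_vec B = (\<chi> p. if p \<in> B then 1 else 0)"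

lemma indicator_vec_nth [simp]: "indicator_vec B $ p = (if p \<in> B then 1 else 0)"
  by (simp add: indicator_vec_def)

definition coord_proj :: "'n::finite set \<Rightarrow> real ^ 'n \<Rightarrow> real ^ 'n" where
  "coord_proj B x = (\<chi> p. if p \<in> B then x $ p else 0)"

lemma coord_proj_nth [simp]: "coord_proj B x $ p = (if p \<in> B then x $ p else 0)"
  by (simp add: coord_proj_def)

lemma linear_coord_proj: "linear (coord_proj B)"
  by (auto simp: linear_iff vec_eq_iff)

lemma coord_proj_in_coord_space [simp]: "coord_proj B x \<in> coord_space B"
  by (simp add: coord_space_def)

lemma coord_proj_add:
  assumes "A \<inter> B = {}" "x \<in> coord_space A" "y \<in> coord_space B"
  shows "coord_proj A (x + y) = x" "coord_proj B (x + y) = y"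
  using assms by (auto simp: coord_space_def vec_eq_iff)

lemma coord_proj_decomp:
  assumes "A \<inter> B = {}" "z \<in> coord_space (A \<union> B)"
  shows "coord_proj A z + coord_proj B z = z"
  using assms by (auto simp: coord_space_def vec_eq_iff)

text \<open>A strictly sorted list in a partial order has distinct entries, so list sums become sums
  over chains as sets.\<close>

lemma chain_polytope_eq:
  assumes po: "partial_order_on A r"
  shows "chain_polytope A r =
    {x \<in> coord_space A. (\<forall>p\<in>A. 0 \<le> x $ p) \<and> (\<forall>K\<in>Chains r. (\<Sum>p\<in>K. x $ p) \<le> 1)}"
proof -
  have "(\<forall>ps. set ps \<subseteq> A \<and> sorted_wrt (\<lambda>p q. (p, q) \<in> r \<and> p \<noteq> q) ps \<longrightarrow> (\<Sum>p\<leftarrow>ps. x $ p) \<le> 1)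
      \<longleftrightarrow> (\<forall>K\<in>Chains r. (\<Sum>p\<in>K. x $ p) \<le> 1)" for x :: "real ^ 'a"
  proof (intro iffI ballI allI impI)
    fix K assume *: "\<forall>ps. set ps \<subseteq> A \<and> sorted_wrt (\<lambda>p q. (p, q) \<in> r \<and> p \<noteq> q) ps \<longrightarrow> (\<Sum>p\<leftarrow>ps. x $ p) \<le> 1"
      and K: "K \<in> Chains r"
    obtain ps where ps: "set ps = K" "sorted_wrt (\<lambda>p q. (p, q) \<in> r \<and> p \<noteq> q) ps"
      using chain_sorted_list[OF _ K partial_order_onD(3,4)[OF po]] by auto
    have "set ps \<subseteq> A" using Chains_partial_order_subset[OF po K] ps by simp
    then have "distinct ps"
      using sorted_list_chain(1)[OF ps(2)] partial_order_onD(2)[OF po] by blast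
    then have "(\<Sum>p\<in>K. x $ p) = (\<Sum>p\<leftarrow>ps. x $ p)"
      using ps(1) by (simp add: sum_list_distinct_conv_sum_set)
    then show "(\<Sum>p\<in>K. x $ p) \<le> 1"
      using * ps \<open>set ps \<subseteq> A\<close> by simp
  next
    fix ps assume *: "\<forall>K\<in>Chains r. (\<Sum>p\<in>K. x $ p) \<le> 1"
      and ps: "set ps \<subseteq> A \<and> sorted_wrt (\<lambda>p q. (p, q) \<in> r \<and> p \<noteq> q) ps"
    have "distinct ps" "set ps \<in> Chains r"
      using sorted_list_chain[of r ps] partial_order_onD(2)[OF po] ps by blast+
    then show "(\<Sum>p\<leftarrow>ps. x $ p) \<le> 1"
      using * by (simp add: sum_list_distinct_conv_sum_set)
  qed
  then show ?thesis by (simp add: chain_polytope_def)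
qed

lemma polyhedron_INT:
  "finite I \<Longrightarrow> (\<And>i. i \<in> I \<Longrightarrow> polyhedron (H i)) \<Longrightarrow> polyhedron (\<Inter>i\<in>I. H i)"
  by (rule polyhedron_Inter) auto

lemma polyhedron_linear_le:
  fixes f :: "'a::euclidean_space \<Rightarrow> real"
  assumes "linear f"
  shows "polyhedron {x. f x \<le> c}"
proof -
  have "f x = adjoint f 1 \<bullet> x" for x
    using adjoint_works[OF assms, of x 1] by (simp add: inner_commute)
  then show ?thesis using polyhedron_halfspace_le[of "adjoint f 1" c] by simp
qed

lemma polyhedron_coord_space: "polyhedron (coord_space A)"
proof -
  have "coord_space A = (\<Inter>p\<in>- A. {x. x $ p \<le> 0} \<inter> {x. - x $ p \<le> 0})"
    by (auto simp: coord_space_def intro: antisym)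
  also have "polyhedron \<dots>"
    by (intro polyhedron_INT polyhedron_Int polyhedron_linear_le) (auto simp: linear_iff)
  finally show ?thesis .
qed

lemma polyhedron_order_polytope: "polyhedron (order_polytope A r)"
proof -
  have "order_polytope A r = coord_space A \<inter> (\<Inter>p\<in>A. {x. - x $ p \<le> 0} \<inter> {x. x $ p \<le> 1})
      \<inter> (\<Inter>(p, q)\<in>r \<inter> A \<times> A. {x. x $ p - x $ q \<le> 0})"
    by (auto simp: order_polytope_def)
  also have "polyhedron \<dots>"
    unfolding case_prod_beta
    by (intro polyhedron_INT polyhedron_Int polyhedron_linear_le polyhedron_coord_space)
       (auto simp: linear_iff algebra_simps)
  finally show ?thesis .
qed

lemma polyhedron_chain_polytope:
  assumes "partial_order_on A r"
  shows "polyhedron (chain_polytope A r)"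
proof -
  have "chain_polytope A r = coord_space A \<inter> (\<Inter>p\<in>A. {x. - x $ p \<le> 0})
      \<inter> (\<Inter>K\<in>Chains r. {x. (\<Sum>p\<in>K. x $ p) \<le> 1})"
    by (auto simp: chain_polytope_eq[OF assms])
  also have "polyhedron \<dots>"
    by (intro polyhedron_INT polyhedron_Int polyhedron_linear_le polyhedron_coord_space)
       (auto simp: linear_iff sum.distrib sum_distrib_left)
  finally show ?thesis .
qed

lemma zero_in_order_polytope: "0 \<in> order_polytope A r"
  by (simp add: order_polytope_def coord_space_def)

lemma zero_in_chain_polytope: "partial_order_on A r \<Longrightarrow> 0 \<in> chain_polytope A r"
  by (simp add: chain_polytope_eq coord_space_def)

lemma zero_extreme_point_nonneg:
  fixes S :: "(real ^ 'n) set"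
  assumes "0 \<in> S" "\<And>x p. x \<in> S \<Longrightarrow> 0 \<le> x $ p"
  shows "0 extreme_point_of S"
  unfolding extreme_point_of_def
proof (intro conjI ballI notI)
  fix a b assume ab: "a \<in> S" "b \<in> S" "0 \<in> open_segment a b"
  then obtain u where u: "a \<noteq> b" "0 < u" "u < 1" "0 = (1 - u) *\<^sub>R a + u *\<^sub>R b"
    by (auto simp: in_segment)
  have "a $ p = b $ p" for p
  proof -
    have "(1 - u) * a $ p + u * b $ p = 0"
      using arg_cong[OF u(4), of "\<lambda>x. x $ p"] by simp
    moreover have "0 \<le> (1 - u) * a $ p" "0 \<le> u * b $ p"
      using u assms(2) ab by auto
    ultimately have "(1 - u) * a $ p = 0" "u * b $ p = 0" by linarith+
    then show ?thesis using u by simp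
  qed
  then show False using u(1) by (simp add: vec_eq_iff)
qed (fact assms(1))

lemma order_polytope_nth:
  assumes "x \<in> order_polytope A r"
  shows "0 \<le> x $ p" "x $ p \<le> 1"
  using assms by (cases "p \<in> A"; simp add: order_polytope_def coord_space_def)+

lemma chain_polytope_nth:
  assumes "partial_order_on A r" "x \<in> chain_polytope A r"
  shows "0 \<le> x $ p" "x $ p \<le> 1"
proof -
  show "0 \<le> x $ p"
    using assms by (cases "p \<in> A"; simp add: chain_polytope_eq coord_space_def)
  show "x $ p \<le> 1"
  proof (cases "p \<in> A")
    case True
    then have "{p} \<in> Chains r"
      using partial_order_onD(2)[OF assms(1)] by (simp add: Chains_def)
    then show ?thesis
      using assms unfolding chain_polytope_eq[OF assms(1)] by fastforce
  next
    case False
    then show ?thesis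
      using assms by (simp add: chain_polytope_eq coord_space_def)
  qed
qed

lemma zero_extreme_point_order_polytope: "0 extreme_point_of order_polytope A r"
  using zero_extreme_point_nonneg zero_in_order_polytope order_polytope_nth(1) by metis

lemma zero_extreme_point_chain_polytope:
  "partial_order_on A r \<Longrightarrow> 0 extreme_point_of chain_polytope A r"
  using zero_extreme_point_nonneg zero_in_chain_polytope chain_polytope_nth(1) by metis

lemma zero_extreme_point_uminus:
  assumes "0 extreme_point_of S"
  shows "0 extreme_point_of (uminus ` S)"
  unfolding extreme_point_of_def
proof (intro conjI ballI notI)
  show "0 \<in> uminus ` S"
    using extreme_point_of_imp_mem[OF assms] by force
  fix a b assume "a \<in> uminus ` S" "b \<in> uminus ` S" "0 \<in> open_segment a b"
  then obtain a' b' u where ab: "a = - a'" "b = - b'" "a' \<in> S" "b' \<in> S"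
    and u: "a \<noteq> b" "0 < u" "u < 1" "0 = (1 - u) *\<^sub>R a + u *\<^sub>R b"
    unfolding in_segment by blast
  have "(1 - u) *\<^sub>R a' + u *\<^sub>R b' = - ((1 - u) *\<^sub>R a + u *\<^sub>R b)"
    by (simp add: ab)
  then have "0 = (1 - u) *\<^sub>R a' + u *\<^sub>R b'"
    by (simp flip: u(4))
  then have "0 \<in> open_segment a' b'"
    using u ab unfolding in_segment by blast
  then show False
    using assms ab unfolding extreme_point_of_def by blast
qed

section \<open>Simplex faces through the origin\<close>

lemma axis_in_chain_polytope:
  assumes "partial_order_on A r" "p \<in> A"
  shows "axis p 1 \<in> chain_polytope A r"
  using assms by (auto simp: chain_polytope_eq coord_space_def axis_def sum.If_cases)

text \<open>Every coordinate of this point is at one of its bounds 0 and 1, so both ends of a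
  segment through it agree with it.\<close>

lemma axis_extreme_point_chain_polytope:
  assumes po: "partial_order_on A r" and p: "p \<in> A"
  shows "axis p 1 extreme_point_of chain_polytope A r"
  unfolding extreme_point_of_def
proof (intro conjI ballI notI)
  fix a b assume ab: "a \<in> chain_polytope A r" "b \<in> chain_polytope A r"
    and "axis p 1 \<in> open_segment a b"
  then obtain u where u: "a \<noteq> b" "0 < u" "u < 1" "axis p 1 = (1 - u) *\<^sub>R a + u *\<^sub>R b"
    unfolding in_segment by blast
  have "a $ q = b $ q" for q
  proof -
    have eq: "(1 - u) * a $ q + u * b $ q = axis p 1 $ q"
      by (simp add: u(4))
    note bounds = chain_polytope_nth[OF po ab(1), of q] chain_polytope_nth[OF po ab(2), of q]
    show ?thesis
    proof (cases "q = p")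
      case True
      then have "(1 - u) * (1 - a $ q) + u * (1 - b $ q) = 0"
        using eq by (simp add: algebra_simps)
      moreover have "0 \<le> (1 - u) * (1 - a $ q)" "0 \<le> u * (1 - b $ q)"
        using u bounds by auto
      ultimately have "(1 - u) * (1 - a $ q) = 0" "u * (1 - b $ q) = 0" by linarith+
      then show ?thesis using u by simp
    next
      case False
      then have "(1 - u) * a $ q + u * b $ q = 0"
        using eq by (simp add: axis_def)
      moreover have "0 \<le> (1 - u) * a $ q" "0 \<le> u * b $ q"
        using u bounds by auto
      ultimately have "(1 - u) * a $ q = 0" "u * b $ q = 0" by linarith+
      then show ?thesis using u by simp
    qed
  qed
  then show False using u(1) by (simp add: vec_eq_iff)
qed (rule axis_in_chain_polytope[OF po p])

text \<open>Since \<open>F\<close> contains the origin, \<open>x\<close> may be shrunk inside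
  \<open>F\<close> until its coordinate sum is below 1. Near the origin the polytope is the whole
  corner, so the \<open>p\<close>-coordinate can be split off: the shrunk point lies between the
  unit vector of \<open>p\<close> and a point \<open>z\<close> of the polytope, and the face
  property puts the unit vector in \<open>F\<close>.\<close>

lemma axis_in_face_at_origin:
  assumes po: "partial_order_on A r" and F: "F face_of chain_polytope A r" "0 \<in> F"
    and x: "x \<in> F" "x $ p \<noteq> 0"
  shows "axis p 1 \<in> F"
proof -
  let ?P = "chain_polytope A r"
  have xP: "x \<in> ?P" using F x face_of_imp_subset by blast
  have nonneg: "0 \<le> x $ q" for q by (rule chain_polytope_nth(1)[OF po xP])
  have outside: "x $ q = 0" if "q \<notin> A" for q
    using xP that by (simp add: chain_polytope_eq[OF po] coord_space_def)
  then have p: "p \<in> A" using x by blast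
  define s where "s = (\<Sum>q\<in>UNIV. x $ q)"
  have "s = x $ p + (\<Sum>q\<in>UNIV - {p}. x $ q)"
    unfolding s_def by (rule sum.remove) auto
  moreover have "0 \<le> (\<Sum>q\<in>UNIV - {p}. x $ q)" by (simp add: nonneg sum_nonneg)
  ultimately have s: "x $ p \<le> s" by simp
  have xp: "0 < x $ p" using nonneg[of p] x by simp
  \<comment> \<open>Shrinking by 1 + s instead of s keeps \<open>l\<close> below 1 even when
    \<open>x\<close> is supported at \<open>p\<close> alone.\<close>
  define l where "l = x $ p / (1 + s)"
  have l: "0 < l" "l < 1" using s xp by (auto simp: l_def)
  define z where "z = (1 / (1 - l)) *\<^sub>R ((1 / (1 + s)) *\<^sub>R x - l *\<^sub>R axis p 1)"
  have z_nth: "z $ q = (if q = p then 0 else x $ q / (1 + s) / (1 - l))" for q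
    by (simp add: z_def l_def axis_def)
  have z_nonneg: "0 \<le> z $ q" for q
    using nonneg[of q] l s xp by (simp add: z_nth)
  have "(\<Sum>q\<in>UNIV. z $ q) = (s / (1 + s) - l) / (1 - l)"
  proof -
    have "(\<Sum>q\<in>UNIV. z $ q) = (1 / (1 - l)) * ((1 / (1 + s)) * s - l * (\<Sum>q\<in>UNIV. axis p 1 $ q))"
      unfolding z_def s_def by (simp add: sum_distrib_left sum_subtractf right_diff_distrib)
    also have "(\<Sum>q\<in>UNIV. axis p 1 $ q) = (1::real)"
      by (simp add: axis_def)
    finally show ?thesis by simp
  qed
  also have "\<dots> \<le> 1"
    using l s xp by (subst divide_le_eq_1_pos) auto
  finally have z_sum: "(\<Sum>q\<in>UNIV. z $ q) \<le> 1" .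
  have zP: "z \<in> ?P"
    unfolding chain_polytope_eq[OF po]
  proof (intro CollectI conjI ballI)
    show "z \<in> coord_space A"
      using outside by (auto simp: coord_space_def z_nth)
    show "0 \<le> z $ q" for q by (rule z_nonneg)
    show "(\<Sum>q\<in>K. z $ q) \<le> 1" for K
      using sum_mono2[of UNIV K "\<lambda>q. z $ q"] z_nonneg z_sum by auto
  qed
  have comb: "(1 / (1 + s)) *\<^sub>R x = (1 - l) *\<^sub>R z + l *\<^sub>R axis p 1"
    using l by (simp add: z_def)
  have "(1 / (1 + s)) *\<^sub>R x \<in> F"
  proof -
    have "(1 / (1 + s)) *\<^sub>R x + (1 - 1 / (1 + s)) *\<^sub>R 0 \<in> F"
      using F x s xp face_of_imp_convex[OF F(1)]
      by (intro convexD) (auto simp: field_simps)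
    then show ?thesis by simp
  qed
  show ?thesis
  proof (cases "z = axis p 1")
    case True
    then show ?thesis
      using comb \<open>(1 / (1 + s)) *\<^sub>R x \<in> F\<close> by (simp flip: scaleR_left.add)
  next
    case False
    then have "(1 / (1 + s)) *\<^sub>R x \<in> open_segment z (axis p 1)"
      using comb l unfolding in_segment by blast
    then show ?thesis
      using face_ofD[OF F(1) _ zP axis_in_chain_polytope[OF po p] \<open>(1 / (1 + s)) *\<^sub>R x \<in> F\<close>] by blast
  qed
qed

text \<open>The unit vectors in the support of any vertex lie in the face and are themselves
  vertices; a further vertex would lie in the span of these, contradicting affine independence. So
  the face is a corner simplex, and it remains to see that its unit vectors belong to comparable
  elements.\<close>

lemma simplex_at_origin_of_chain_polytope:
  assumes po: "partial_order_on A r" and C: "C \<in> simplex_vertex_sets (chain_polytope A r)" "0 \<in> C"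
  defines "K \<equiv> {p. axis p 1 \<in> C}"
  shows "C = insert 0 ((\<lambda>p. axis p 1) ` K)" "K \<in> Chains r"
proof -
  let ?P = "chain_polytope A r" and ?H = "convex hull C"
  note C' = simplex_vertex_setsD[OF C(1)]
  have 0: "0 \<in> ?H" using C(2) by (rule hull_inc)
  have KA: "p \<in> A" if "p \<in> K" for p
  proof (rule ccontr)
    assume "p \<notin> A"
    moreover have "axis p 1 \<in> ?P" using that C'(4) by (auto simp: K_def)
    then have "\<forall>q. q \<notin> A \<longrightarrow> axis p (1::real) $ q = 0"
      unfolding chain_polytope_eq[OF po] coord_space_def by blast
    ultimately have "axis p (1::real) $ p = 0" by blast
    then show False by simp
  qed
  have axis: "p \<in> K" if "x \<in> C" "x $ p \<noteq> 0" for x p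
  proof -
    have "p \<in> A"
    proof (rule ccontr)
      assume "p \<notin> A"
      moreover have "x \<in> ?P" using that C'(4) by auto
      ultimately show False
        using that by (simp add: chain_polytope_eq[OF po] coord_space_def)
    qed
    moreover have "axis p 1 \<in> ?H"
      by (rule axis_in_face_at_origin[OF po C'(2) 0 hull_inc[OF that(1)] that(2)])
    ultimately show ?thesis
      using mem_simplex_vertex_set_iff[OF C(1)] axis_extreme_point_chain_polytope[OF po]
      by (simp add: K_def)
  qed
  show eq: "C = insert 0 ((\<lambda>p. axis p 1) ` K)"
  proof
    show "insert 0 ((\<lambda>p. axis p 1) ` K) \<subseteq> C"
      using C(2) by (auto simp: K_def)
    show "C \<subseteq> insert 0 ((\<lambda>p. axis p 1) ` K)" (is "_ \<subseteq> ?E")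
    proof (rule ccontr)
      assume "\<not> C \<subseteq> ?E"
      then obtain x where x: "x \<in> C" "x \<notin> ?E" by blast
      have "(\<Sum>p\<in>UNIV. x $ p *\<^sub>R axis p 1) \<in> span ?E"
      proof (rule span_sum)
        fix p
        show "x $ p *\<^sub>R axis p 1 \<in> span ?E"
          using axis[OF x(1), of p] by (cases "x $ p = 0") (auto intro: span_base span_scale span_zero)
      qed
      moreover have "(\<Sum>p\<in>UNIV. x $ p *\<^sub>R axis p 1) = x"
        using basis_expansion[of x] by (simp add: scalar_mult_eq_scaleR)
      \<comment> \<open>The origin is in \<open>?E\<close>, so the affine hull of \<open>?E\<close>
        is its span.\<close>
      ultimately have "x \<in> affine hull ?E"
        by (simp add: affine_hull_span_0 hull_inc)
      moreover have "?E \<subseteq> C - {x}"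
        using \<open>?E \<subseteq> C\<close> x by blast
      ultimately have "x \<in> affine hull (C - {x})"
        using hull_mono by blast
      then show False
        using C'(1) x unfolding affine_dependent_def by blast
    qed
  qed
  show "K \<in> Chains r"
  proof (rule Chains_partial_orderI[OF po])
    show "K \<subseteq> A" using KA by blast
    fix p q assume pq: "p \<in> K" "q \<in> K" "p \<noteq> q"
    show "(p, q) \<in> r \<or> (q, p) \<in> r"
    proof (rule ccontr)
      assume incomp: "\<not> ?thesis"
      let ?e = "axis p 1 + axis q 1 :: real ^ 'a"
      have eP: "?e \<in> ?P"
        unfolding chain_polytope_eq[OF po]
      proof (intro CollectI conjI ballI)
        show "?e \<in> coord_space A"
          using KA pq by (auto simp: coord_space_def axis_def)
        show "0 \<le> ?e $ i" for i by (simp add: axis_def)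
        fix L assume "L \<in> Chains r"
        then have "p \<notin> L \<or> q \<notin> L"
          using incomp by (auto simp: Chains_def)
        then show "(\<Sum>i\<in>L. ?e $ i) \<le> 1"
          by (auto simp: sum.distrib axis_def sum.If_cases)
      qed
      \<comment> \<open>For incomparable \<open>p\<close> and \<open>q\<close> the sum
        \<open>?e\<close> is in the polytope, and this midpoint of two vertices of the face is also
        the midpoint of 0 and \<open>?e\<close>. The face would thus contain \<open>?e\<close>,
        whose coordinate sum 2 exceeds the bound 1 valid on the hull.\<close>
      have mid: "(1 / 2) *\<^sub>R axis p 1 + (1 / 2) *\<^sub>R axis q 1 \<in> ?H"
        using pq by (intro convexD[OF convex_convex_hull]) (auto simp: K_def intro: hull_inc)
      have "?e $ p \<noteq> 0" using pq by (simp add: axis_def)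
      then have "?e \<noteq> 0" by (metis zero_index)
      then have "(1 / 2) *\<^sub>R axis p 1 + (1 / 2) *\<^sub>R axis q 1 \<in> open_segment 0 ?e"
        unfolding in_segment by (auto intro!: exI[of _ "1 / 2"] simp: scaleR_add_right)
      then have "?e \<in> ?H"
        using face_ofD[OF C'(2) _ _ eP mid] zero_in_chain_polytope[OF po] by blast
      moreover have "?H \<subseteq> {x. (\<chi> i. 1) \<bullet> x \<le> 1}"
      proof (rule hull_minimal)
        show "C \<subseteq> {x. (\<chi> i. 1) \<bullet> x \<le> 1}"
          unfolding eq by (auto simp: inner_axis)
      qed (rule convex_halfspace_le)
      ultimately have "(\<chi> i. 1) \<bullet> ?e \<le> 1" by blast
      then show False by (simp add: inner_add_right inner_axis)
    qed
  qed
qed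

lemma faces_at_origin_chain_polytope_le:
  assumes po: "partial_order_on A r"
  shows "faces_at_origin k (chain_polytope A r) \<le> card {K \<in> Chains r. card K = k}"
  unfolding faces_at_origin_def
proof (rule card_inj_on_le)
  let ?X = "{C \<in> simplex_vertex_sets (chain_polytope A r). 0 \<in> C \<and> card C = Suc k}"
  let ?K = "\<lambda>C::(real ^ 'a) set. {p. axis p 1 \<in> C}"
  note * = simplex_at_origin_of_chain_polytope[OF po]
  show "inj_on ?K ?X"
  proof (rule inj_onI)
    fix C D assume "C \<in> ?X" "D \<in> ?X" "?K C = ?K D"
    then show "C = D" using *(1)[of C] *(1)[of D] by simp
  qed
  show "?K ` ?X \<subseteq> {K \<in> Chains r. card K = k}"
  proof (rule image_subsetI)
    have inj: "inj (\<lambda>p. axis p 1 :: real ^ 'a)"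
      by (auto simp: inj_on_def axis_eq_axis)
    fix C assume C: "C \<in> ?X"
    then have "C = insert 0 ((\<lambda>p. axis p 1) ` ?K C)"
      using *(1)[of C] by blast
    from arg_cong[where f = card, OF this]
    have "card C = card (insert 0 ((\<lambda>p. axis p (1::real)) ` ?K C))" .
    also have "\<dots> = Suc (card (?K C))"
      by (subst card_insert_disjoint) (auto simp: axis_eq_0_iff card_image[OF inj_on_subset[OF inj]])
    finally show "?K C \<in> {K \<in> Chains r. card K = k}"
      using *(2)[of C] C by simp
  qed
  show "finite {K \<in> Chains r. card K = k}" by simp
qed

section \<open>Order polytope: simplex faces spanned by nested principal filters\<close>

lemma convex_sum_with_zero:
  assumes "convex S" "0 \<in> S" "finite I" "\<And>i. i \<in> I \<Longrightarrow> 0 \<le> u i" "sum u I \<le> 1"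
    and "\<And>i. i \<in> I \<Longrightarrow> y i \<in> S"
  shows "(\<Sum>i\<in>I. u i *\<^sub>R y i) \<in> S"
proof (cases "sum u I = 0")
  case True
  then have "\<forall>i\<in>I. u i = 0"
    using assms(3,4) by (simp add: sum_nonneg_eq_0_iff)
  then show ?thesis using assms(2) by simp
next
  case False
  then have pos: "0 < sum u I"
    using assms(4) by (metis sum_nonneg less_le)
  have "(\<Sum>i\<in>I. (u i / sum u I) *\<^sub>R y i) \<in> S"
    using assms pos False by (intro convex_sum) (auto simp: sum_divide_distrib[symmetric])
  then have "sum u I *\<^sub>R (\<Sum>i\<in>I. (u i / sum u I) *\<^sub>R y i) + (1 - sum u I) *\<^sub>R 0 \<in> S"
    using assms pos by (intro convexD) auto
  moreover have "sum u I *\<^sub>R (\<Sum>i\<in>I. (u i / sum u I) *\<^sub>R y i) = (\<Sum>i\<in>I. u i *\<^sub>R y i)"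
    using False by (simp add: scaleR_sum_right)
  ultimately show ?thesis by simp
qed

text \<open>The 0/1 points of the order polytope are the indicators of filters. For a chain
  \<open>K\<close> the principal filters are nested, and the added 0 is the empty filter.\<close>

definition chain_filter_vertices :: "'n::finite rel \<Rightarrow> 'n set \<Rightarrow> (real ^ 'n) set" where
  "chain_filter_vertices r K = insert 0 ((\<lambda>p. indicator_vec (r `` {p})) ` K)"

lemma indicator_vec_upset_inject:
  assumes po: "partial_order_on A r" and pq: "p \<in> A" "q \<in> A"
    and eq: "indicator_vec (r `` {p}) = indicator_vec (r `` {q})"
  shows "p = q"
proof -
  have "x \<in> r `` {p} \<longleftrightarrow> x \<in> r `` {q}" for x
    using arg_cong[OF eq, of "\<lambda>v. v $ x"] by (simp split: if_splits)
  then have "(p, q) \<in> r" "(q, p) \<in> r"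
    using partial_order_onD(2)[OF po] pq by auto
  then show ?thesis
    using partial_order_onD(4)[OF po] by (auto dest: antisymD)
qed

lemma indicator_vec_upset_nonzero:
  assumes "partial_order_on A r" "p \<in> A"
  shows "indicator_vec (r `` {p}) \<noteq> 0"
proof -
  have "indicator_vec (r `` {p}) $ p = 1"
    using partial_order_onD(2)[OF assms] by simp
  then show ?thesis by (metis zero_index zero_neq_one)
qed

lemma card_chain_filter_vertices:
  assumes po: "partial_order_on A r" and K: "K \<subseteq> A"
  shows "card (chain_filter_vertices r K) = Suc (card K)"
proof -
  have "inj_on (\<lambda>p. indicator_vec (r `` {p})) K"
    by (rule inj_onI) (use indicator_vec_upset_inject[OF po] K in blast)
  moreover have "0 \<notin> (\<lambda>p. indicator_vec (r `` {p})) ` K"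
    using indicator_vec_upset_nonzero[OF po] K by force
  ultimately show ?thesis
    by (simp add: chain_filter_vertices_def card_image)
qed

text \<open>At coordinate \<open>q\<close> in \<open>K\<close>, a linear relation among the filter
  indicators says that the coefficients of the elements of \<open>K\<close> below \<open>q\<close>
  sum to 0; triangularity does the rest.\<close>

lemma affine_independent_chain_filter_vertices:
  assumes po: "partial_order_on A r" and K: "K \<subseteq> A"
  shows "\<not> affine_dependent (chain_filter_vertices r K)"
proof
  let ?v = "\<lambda>p. indicator_vec (r `` {p})"
  assume dep: "affine_dependent (chain_filter_vertices r K)"
  have inj: "inj_on ?v K"
    by (rule inj_onI) (use indicator_vec_upset_inject[OF po] K in blast)
  have 0: "0 \<notin> ?v ` K"
    using indicator_vec_upset_nonzero[OF po] K by force
  have "dependent (?v ` K)"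
    using dep affine_dependent_iff_dependent[OF 0] by (simp add: chain_filter_vertices_def)
  then obtain U p where U: "p \<in> K" "U (?v p) \<noteq> 0" "(\<Sum>w\<in>?v ` K. U w *\<^sub>R w) = 0"
    using dependent_finite[of "?v ` K"] by auto
  have sum0: "(\<Sum>p\<in>K. U (?v p) *\<^sub>R ?v p) = 0"
    using U(3) by (simp add: sum.reindex[OF inj])
  have "U (?v p) = 0"
  proof (rule vanishing_if_downset_sums_vanish[where A = K and B = K and y = "\<lambda>p. U (?v p)"])
    fix q assume "q \<in> K"
    have "0 = (\<Sum>p\<in>K. U (?v p) *\<^sub>R ?v p) $ q" by (simp add: sum0)
    also have "\<dots> = (\<Sum>p\<in>K. if (p, q) \<in> r then U (?v p) else 0)"
      by (simp only: sum_component) (rule sum.cong, auto)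
    also have "\<dots> = (\<Sum>p | p \<in> K \<and> (p, q) \<in> r. U (?v p))"
      by (simp add: sum.inter_filter)
    finally show "(\<Sum>p | p \<in> K \<and> (p, q) \<in> r. U (?v p)) = 0" by simp
  qed (use partial_order_onD[OF po] K U(1) in auto)
  with U show False by simp
qed

text \<open>\<open>D\<close> makes some defining inequalities tight: a coordinate is 0 if nothing of
  \<open>K\<close> lies below it, and otherwise equals the coordinate at the greatest element of
  \<open>K\<close> below it. So \<open>D\<close> is a face whose points are determined by their
  values on \<open>K\<close>.\<close>

lemma chain_filter_vertices_face:
  assumes po: "partial_order_on A r" and K: "K \<in> Chains r"
  shows "convex hull (chain_filter_vertices r K) face_of order_polytope A r"
proof -
  let ?v = "\<lambda>p. indicator_vec (r `` {p}) :: real ^ 'a"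
  let ?top = "\<lambda>p q. (p, q) \<in> r \<and> (\<forall>p'\<in>K. (p', q) \<in> r \<longrightarrow> (p', p) \<in> r)"
  define D where "D = {x \<in> order_polytope A r. \<forall>q\<in>A.
      ((\<forall>p\<in>K. (p, q) \<notin> r) \<longrightarrow> x $ q = 0) \<and> (\<forall>p\<in>K. ?top p q \<longrightarrow> x $ q = x $ p)}"
  have KA: "K \<subseteq> A" by (rule Chains_partial_order_subset[OF po K])
  note tr = partial_order_onD[OF po]
  have mono: "x $ p \<le> x $ q" if "x \<in> order_polytope A r" "(p, q) \<in> r" for x p q
    using that tr(1) by (auto simp: order_polytope_def)
  have face: "D face_of order_polytope A r"
    unfolding face_of_def
  proof (intro conjI ballI impI)
    show "D \<subseteq> order_polytope A r" by (auto simp: D_def)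
    show "convex D"
    proof (rule convexI)
      fix x y :: "real ^ 'a" and u v :: real
      assume xy: "x \<in> D" "y \<in> D" and uv: "0 \<le> u" "0 \<le> v" "u + v = 1"
      have "u *\<^sub>R x + v *\<^sub>R y \<in> order_polytope A r"
        using convexD[OF polyhedron_imp_convex[OF polyhedron_order_polytope] _ _ uv] xy
        by (auto simp: D_def)
      then show "u *\<^sub>R x + v *\<^sub>R y \<in> D"
        using xy by (auto simp: D_def)
    qed
    have one: "a \<in> D" if a: "a \<in> order_polytope A r" and b: "b \<in> order_polytope A r"
      and x: "x \<in> D" and u: "0 < u" "u < 1" "x = (1 - u) *\<^sub>R a + u *\<^sub>R b" for a b x u
    proof -
      have "a $ q = 0" if "q \<in> A" "\<forall>p\<in>K. (p, q) \<notin> r" for q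
      proof -
        have "(1 - u) * a $ q + u * b $ q = 0"
          using x that u(3) by (auto simp: D_def)
        moreover have "0 \<le> (1 - u) * a $ q" "0 \<le> u * b $ q"
          using u order_polytope_nth(1)[OF a] order_polytope_nth(1)[OF b] by auto
        ultimately have "(1 - u) * a $ q = 0" by linarith
        then show ?thesis using u by simp
      qed
      moreover have "a $ q = a $ p" if "q \<in> A" "p \<in> K" "?top p q" for p q
      proof -
        have "x $ q = x $ p" using x that by (auto simp: D_def)
        then have "(1 - u) * (a $ q - a $ p) + u * (b $ q - b $ p) = 0"
          by (simp add: u(3) algebra_simps)
        moreover have "0 \<le> (1 - u) * (a $ q - a $ p)" "0 \<le> u * (b $ q - b $ p)"
          using u mono[OF a, of p q] mono[OF b, of p q] that by auto
        ultimately have "(1 - u) * (a $ q - a $ p) = 0" by linarith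
        then show ?thesis using u by simp
      qed
      ultimately show ?thesis using a by (auto simp: D_def)
    qed
    fix a b x assume ab: "a \<in> order_polytope A r" "b \<in> order_polytope A r" and x: "x \<in> D"
      and "x \<in> open_segment a b"
    then obtain u where u: "0 < u" "u < 1" "x = (1 - u) *\<^sub>R a + u *\<^sub>R b"
      unfolding in_segment by blast
    show "a \<in> D" by (rule one[OF ab x u])
    show "b \<in> D"
      by (rule one[OF ab(2,1) x, of "1 - u"]) (use u in \<open>auto simp: add.commute\<close>)
  qed
  have "convex hull (chain_filter_vertices r K) = D"
  proof
    show "convex hull (chain_filter_vertices r K) \<subseteq> D"
    proof (rule hull_minimal)
      show "convex D" by (rule face_of_imp_convex[OF face])
      have "0 \<in> D" using zero_in_order_polytope by (simp add: D_def)
      moreover have "?v p \<in> D" if "p \<in> K" for p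
        using that KA tr(1) transD[OF tr(3)]
        by (auto simp: D_def order_polytope_def coord_space_def)
      ultimately show "chain_filter_vertices r K \<subseteq> D"
        by (auto simp: chain_filter_vertices_def)
    qed
    show "D \<subseteq> convex hull (chain_filter_vertices r K)"
    proof
      fix x assume x: "x \<in> D"
      then have xP: "x \<in> order_polytope A r" by (simp add: D_def)
      \<comment> \<open>The coefficients of \<open>x\<close> in the filter indicators are its
        increments along \<open>K\<close>; their sum is the value at the top of \<open>K\<close>,
        hence at most 1, and the remaining weight goes to the origin.\<close>
      define u where "u = increment r K (\<lambda>p. x $ p)"
      have u_nonneg: "0 \<le> u p" for p
        unfolding u_def
        by (rule increment_nonneg) (use order_polytope_nth(1)[OF xP] mono[OF xP] in auto)
      have u_sum: "(\<Sum>q | q \<in> K \<and> (q, p) \<in> r. u q) = x $ p" if "p \<in> K" for p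
        unfolding u_def
        by (rule sum_increments)
           (use that KA tr order_polytope_nth(1)[OF xP] mono[OF xP] Chains_subset[OF K] in auto)
      have u_le: "sum u K \<le> 1"
      proof (cases "K = {}")
        case False
        then obtain m where m: "m \<in> K" "\<forall>q\<in>K. (q, m) \<in> r"
          using finite_chain_has_max[OF _ False K tr(3)] by auto
        then have "{q. q \<in> K \<and> (q, m) \<in> r} = K" by auto
        then show ?thesis
          using u_sum[OF m(1)] order_polytope_nth(2)[OF xP] by simp
      qed simp
      have "x = (\<Sum>p\<in>K. u p *\<^sub>R ?v p)"
      proof (rule vec_eq_iff[THEN iffD2], rule allI)
        fix q
        have "(\<Sum>p\<in>K. u p *\<^sub>R ?v p) $ q = (\<Sum>p\<in>K. if (p, q) \<in> r then u p else 0)"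
          by (simp only: sum_component) (rule sum.cong, auto)
        also have "\<dots> = (\<Sum>p | p \<in> K \<and> (p, q) \<in> r. u p)"
          by (simp add: sum.inter_filter)
        also have "\<dots> = x $ q"
        proof (cases "\<exists>p\<in>K. (p, q) \<in> r")
          case False
          then have *: "{p. p \<in> K \<and> (p, q) \<in> r} = {}" by blast
          have "x $ q = 0"
            using x False by (cases "q \<in> A") (auto simp: D_def order_polytope_def coord_space_def)
          then show ?thesis unfolding * by simp
        next
          case True
          then obtain m where m: "m \<in> K" "(m, q) \<in> r" "\<forall>p\<in>K. (p, q) \<in> r \<longrightarrow> (p, m) \<in> r"
            using finite_chain_has_max[of "{p\<in>K. (p, q) \<in> r}" r] Chains_subset[OF K] tr(3) by auto
          have "{p. p \<in> K \<and> (p, q) \<in> r} = {p. p \<in> K \<and> (p, m) \<in> r}"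
            using m transD[OF tr(3)] by blast
          moreover have "q \<in> A" using m tr(1) by blast
          ultimately show ?thesis
            using u_sum[OF m(1)] x m by (auto simp: D_def)
        qed
        finally show "x $ q = (\<Sum>p\<in>K. u p *\<^sub>R ?v p) $ q" by simp
      qed
      also have "\<dots> \<in> convex hull (chain_filter_vertices r K)"
        by (rule convex_sum_with_zero)
           (use u_nonneg u_le in \<open>auto simp: chain_filter_vertices_def intro: hull_inc\<close>)
      finally show "x \<in> convex hull (chain_filter_vertices r K)" .
    qed
  qed
  with face show ?thesis by simp
qed

lemma faces_at_origin_order_polytope_ge:
  assumes po: "partial_order_on A r"
  shows "card {K \<in> Chains r. card K = k} \<le> faces_at_origin k (order_polytope A r)"
  unfolding faces_at_origin_def
proof (rule card_inj_on_le)
  note sub = Chains_partial_order_subset[OF po]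
  show "inj_on (chain_filter_vertices r) {K \<in> Chains r. card K = k}"
  proof (rule inj_onI)
    have *: "p \<in> K \<longleftrightarrow> p \<in> A \<and> indicator_vec (r `` {p}) \<in> chain_filter_vertices r K"
      if "K \<in> Chains r" for p K
      using sub[OF that] indicator_vec_upset_nonzero[OF po] indicator_vec_upset_inject[OF po]
      unfolding chain_filter_vertices_def by blast
    fix K L assume "K \<in> {K \<in> Chains r. card K = k}" "L \<in> {K \<in> Chains r. card K = k}"
      and eq: "chain_filter_vertices r K = chain_filter_vertices r L"
    then show "K = L" using *[of K] *[of L] by auto
  qed
  show "chain_filter_vertices r ` {K \<in> Chains r. card K = k} \<subseteq>
      {C \<in> simplex_vertex_sets (order_polytope A r). 0 \<in> C \<and> card C = Suc k}"
    using chain_filter_vertices_face[OF po] affine_independent_chain_filter_vertices[OF po sub]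
      card_chain_filter_vertices[OF po sub]
    by (auto simp: simplex_vertex_sets_def) (simp add: chain_filter_vertices_def)
  show "finite {C \<in> simplex_vertex_sets (order_polytope A r). 0 \<in> C \<and> card C = Suc k}"
    using finite_simplex_vertex_sets[OF polyhedron_order_polytope[of A r]]
    by (rule finite_subset[rotated]) auto
qed

section \<open>Disjoint unions and ordinal sums\<close>

text \<open>On complementary coordinate subspaces, addition is inverted by the pair of coordinate
  projections.\<close>

lemma simplex_face_count_add_image:
  assumes "A \<inter> B = {}" and S: "S \<subseteq> coord_space A \<times> coord_space B"
  shows "simplex_face_count k ((\<lambda>(x, y). x + y) ` S) = simplex_face_count k S"
proof (rule simplex_face_count_linear_image)
  show "linear (\<lambda>(x, y). x + y :: real ^ 'a)"
    by (simp add: linear_iff case_prod_beta algebra_simps)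
  show "linear (\<lambda>z. (coord_proj A z, coord_proj B z))"
    by (simp add: linear_iff linear_add[OF linear_coord_proj] linear_scale[OF linear_coord_proj])
  fix p assume "p \<in> S"
  then show "(\<lambda>z. (coord_proj A z, coord_proj B z)) ((\<lambda>(x, y). x + y) p) = p"
    using S coord_proj_add[OF assms(1)] by (cases p) auto
qed

lemma order_polytope_subset_coord_space: "order_polytope A r \<subseteq> coord_space A"
  by (auto simp: order_polytope_def)

lemma chain_polytope_subset_coord_space: "chain_polytope A r \<subseteq> coord_space A"
  by (auto simp: chain_polytope_def)

lemma order_polytope_disjoint_union:
  assumes r: "partial_order_on A r" and s: "partial_order_on B s" and AB: "A \<inter> B = {}"
  shows "order_polytope (A \<union> B) (r \<union> s)
    = (\<lambda>(x, y). x + y) ` (order_polytope A r \<times> order_polytope B s)"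
proof
  note rs = partial_order_onD(1)[OF r] partial_order_onD(1)[OF s]
  show "order_polytope (A \<union> B) (r \<union> s) \<subseteq> (\<lambda>(x, y). x + y) ` (order_polytope A r \<times> order_polytope B s)"
  proof
    fix z assume z: "z \<in> order_polytope (A \<union> B) (r \<union> s)"
    then have "coord_proj A z \<in> order_polytope A r" "coord_proj B z \<in> order_polytope B s"
      by (auto simp: order_polytope_def coord_space_def)
    moreover have "z = coord_proj A z + coord_proj B z"
      using z coord_proj_decomp[OF AB, of z] by (simp add: order_polytope_def)
    ultimately show "z \<in> (\<lambda>(x, y). x + y) ` (order_polytope A r \<times> order_polytope B s)"
      by (auto intro!: image_eqI[of _ _ "(coord_proj A z, coord_proj B z)"])
  qed
  show "(\<lambda>(x, y). x + y) ` (order_polytope A r \<times> order_polytope B s) \<subseteq> order_polytope (A \<union> B) (r \<union> s)"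
  proof clarify
    fix x y assume x: "x \<in> order_polytope A r" and y: "y \<in> order_polytope B s"
    have x0: "x $ p = 0" if "p \<notin> A" for p
      using x that by (simp add: order_polytope_def coord_space_def)
    have y0: "y $ p = 0" if "p \<notin> B" for p
      using y that by (simp add: order_polytope_def coord_space_def)
    show "x + y \<in> order_polytope (A \<union> B) (r \<union> s)"
      unfolding order_polytope_def
    proof (intro CollectI conjI ballI impI)
      show "x + y \<in> coord_space (A \<union> B)"
        using x0 y0 by (simp add: coord_space_def)
      fix p
      show "0 \<le> (x + y) $ p"
        using order_polytope_nth(1)[OF x, of p] order_polytope_nth(1)[OF y, of p] by simp
      show "(x + y) $ p \<le> 1"
      proof -
        have "x $ p = 0 \<or> y $ p = 0" using AB x0 y0 by blast
        then show ?thesis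
          using order_polytope_nth(2)[OF x, of p] order_polytope_nth(2)[OF y, of p] by auto
      qed
      fix q assume "(p, q) \<in> r \<union> s"
      then show "(x + y) $ p \<le> (x + y) $ q"
      proof
        assume "(p, q) \<in> r"
        then have "p \<in> A" "q \<in> A" "x $ p \<le> x $ q"
          using rs x by (auto simp: order_polytope_def)
        moreover from this have "y $ p = 0" "y $ q = 0" using AB y0 by blast+
        ultimately show ?thesis by simp
      next
        assume "(p, q) \<in> s"
        then have "p \<in> B" "q \<in> B" "y $ p \<le> y $ q"
          using rs y by (auto simp: order_polytope_def)
        moreover from this have "x $ p = 0" "x $ q = 0" using AB x0 by blast+
        ultimately show ?thesis by simp
      qed
    qed
  qed
qed

lemma partial_order_on_disjoint_union:
  assumes "partial_order_on A r" "partial_order_on B s" "A \<inter> B = {}"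
  shows "partial_order_on (A \<union> B) (r \<union> s)"
  unfolding partial_order_on_def preorder_on_def refl_on_def
proof (intro conjI)
  note r = partial_order_onD[OF assms(1)] and s = partial_order_onD[OF assms(2)]
  show "r \<union> s \<subseteq> (A \<union> B) \<times> (A \<union> B)" using r(1) s(1) by blast
  show "\<forall>x\<in>A \<union> B. (x, x) \<in> r \<union> s" using r(2) s(2) by blast
  show "trans (r \<union> s)"
    using transD[OF r(3)] transD[OF s(3)] r(1) s(1) assms(3) by (intro transI) blast
  show "antisym (r \<union> s)"
    using antisymD[OF r(4)] antisymD[OF s(4)] r(1) s(1) assms(3) by (intro antisymI) blast
qed

lemma partial_order_on_ordinal_sum:
  assumes "partial_order_on A r" "partial_order_on B s" "A \<inter> B = {}"
  shows "partial_order_on (A \<union> B) (r \<union> s \<union> A \<times> B)"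
  unfolding partial_order_on_def preorder_on_def refl_on_def
proof (intro conjI)
  note r = partial_order_onD[OF assms(1)] and s = partial_order_onD[OF assms(2)]
  show "r \<union> s \<union> A \<times> B \<subseteq> (A \<union> B) \<times> (A \<union> B)" using r(1) s(1) by blast
  show "\<forall>x\<in>A \<union> B. (x, x) \<in> r \<union> s \<union> A \<times> B" using r(2) s(2) by blast
  show "trans (r \<union> s \<union> A \<times> B)"
    using transD[OF r(3)] transD[OF s(3)] r(1) s(1) assms(3) by (intro transI) blast
  show "antisym (r \<union> s \<union> A \<times> B)"
    using antisymD[OF r(4)] antisymD[OF s(4)] r(1) s(1) assms(3) by (intro antisymI) blast
qed

lemma Chains_disjoint_union:
  assumes "partial_order_on A r" "partial_order_on B s" "A \<inter> B = {}"
  shows "Chains (r \<union> s) = Chains r \<union> Chains s"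
proof
  note r = partial_order_onD(1)[OF assms(1)] and s = partial_order_onD(1)[OF assms(2)]
  show "Chains (r \<union> s) \<subseteq> Chains r \<union> Chains s"
  proof
    fix K assume K: "K \<in> Chains (r \<union> s)"
    show "K \<in> Chains r \<union> Chains s"
    proof (cases "K \<subseteq> A")
      case True
      then have "K \<in> Chains r"
        using K s assms(3) unfolding Chains_def by blast
      then show ?thesis ..
    next
      case False
      then obtain p where p: "p \<in> K" "p \<notin> A" by blast
      then have "p \<in> B"
        using K r s unfolding Chains_def by blast
      have "q \<in> B" if "q \<in> K" for q
      proof -
        have "(p, q) \<in> r \<union> s \<or> (q, p) \<in> r \<union> s"
          using K that p unfolding Chains_def by blast
        then show ?thesis using p r s by blast
      qed
      then have "K \<in> Chains s"
        using K r assms(3) unfolding Chains_def by blast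
      then show ?thesis ..
    qed
  qed
  show "Chains r \<union> Chains s \<subseteq> Chains (r \<union> s)"
    by (auto simp: Chains_def)
qed

lemma Chains_ordinal_sum:
  assumes "partial_order_on A r" "partial_order_on B s" "A \<inter> B = {}"
  shows "K \<in> Chains (r \<union> s \<union> A \<times> B) \<longleftrightarrow>
    K \<subseteq> A \<union> B \<and> K \<inter> A \<in> Chains r \<and> K \<inter> B \<in> Chains s"
proof -
  note r = partial_order_onD(1)[OF assms(1)] and s = partial_order_onD(1)[OF assms(2)]
  have "K \<subseteq> A \<union> B" if "K \<in> Chains (r \<union> s \<union> A \<times> B)"
    using Chains_partial_order_subset[OF partial_order_on_ordinal_sum[OF assms] that] .
  moreover have "K \<inter> A \<in> Chains r" "K \<inter> B \<in> Chains s" if "K \<in> Chains (r \<union> s \<union> A \<times> B)"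
    using that r s assms(3) unfolding Chains_def by blast+
  moreover have "K \<in> Chains (r \<union> s \<union> A \<times> B)"
    if "K \<subseteq> A \<union> B" "K \<inter> A \<in> Chains r" "K \<inter> B \<in> Chains s"
    unfolding Chains_def
  proof (intro CollectI ballI)
    fix p q assume "p \<in> K" "q \<in> K"
    then show "(p, q) \<in> r \<union> s \<union> A \<times> B \<or> (q, p) \<in> r \<union> s \<union> A \<times> B"
      using that unfolding Chains_def by blast
  qed
  ultimately show ?thesis by blast
qed

lemma sum_coord_space_Int:
  assumes "x \<in> coord_space A"
  shows "(\<Sum>p\<in>K. x $ p) = (\<Sum>p\<in>K \<inter> A. x $ p)"
  by (rule sum.mono_neutral_right) (use assms in \<open>auto simp: coord_space_def\<close>)

lemma chain_polytope_disjoint_union: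
  assumes r: "partial_order_on A r" and s: "partial_order_on B s" and AB: "A \<inter> B = {}"
  shows "chain_polytope (A \<union> B) (r \<union> s)
    = (\<lambda>(x, y). x + y) ` (chain_polytope A r \<times> chain_polytope B s)"
proof
  note po = partial_order_on_disjoint_union[OF assms]
  note eqs = chain_polytope_eq[OF r] chain_polytope_eq[OF s] chain_polytope_eq[OF po]
    Chains_disjoint_union[OF assms]
  show "chain_polytope (A \<union> B) (r \<union> s) \<subseteq> (\<lambda>(x, y). x + y) ` (chain_polytope A r \<times> chain_polytope B s)"
  proof
    fix z assume z: "z \<in> chain_polytope (A \<union> B) (r \<union> s)"
    have "(\<Sum>p\<in>K. coord_proj A z $ p) \<le> 1" if "K \<in> Chains r" for K
    proof -
      have "(\<Sum>p\<in>K. coord_proj A z $ p) = (\<Sum>p\<in>K. z $ p)"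
        by (rule sum.cong) (use Chains_partial_order_subset[OF r that] in auto)
      then show ?thesis using z that by (simp add: eqs)
    qed
    then have "coord_proj A z \<in> chain_polytope A r"
      using z by (simp add: eqs)
    moreover have "(\<Sum>p\<in>K. coord_proj B z $ p) \<le> 1" if "K \<in> Chains s" for K
    proof -
      have "(\<Sum>p\<in>K. coord_proj B z $ p) = (\<Sum>p\<in>K. z $ p)"
        by (rule sum.cong) (use Chains_partial_order_subset[OF s that] in auto)
      then show ?thesis using z that by (simp add: eqs)
    qed
    then have "coord_proj B z \<in> chain_polytope B s"
      using z by (simp add: eqs)
    moreover have "z = coord_proj A z + coord_proj B z"
      using z coord_proj_decomp[OF AB, of z] by (simp add: eqs)
    ultimately show "z \<in> (\<lambda>(x, y). x + y) ` (chain_polytope A r \<times> chain_polytope B s)"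
      by (auto intro!: image_eqI[of _ _ "(coord_proj A z, coord_proj B z)"])
  qed
  show "(\<lambda>(x, y). x + y) ` (chain_polytope A r \<times> chain_polytope B s) \<subseteq> chain_polytope (A \<union> B) (r \<union> s)"
  proof clarify
    fix x y assume x: "x \<in> chain_polytope A r" and y: "y \<in> chain_polytope B s"
    have x0: "x $ p = 0" if "p \<notin> A" for p
      using x that by (simp add: eqs coord_space_def)
    have y0: "y $ p = 0" if "p \<notin> B" for p
      using y that by (simp add: eqs coord_space_def)
    show "x + y \<in> chain_polytope (A \<union> B) (r \<union> s)"
      unfolding eqs
    proof (intro CollectI conjI ballI)
      show "x + y \<in> coord_space (A \<union> B)"
        using x0 y0 by (simp add: coord_space_def)
      show "0 \<le> (x + y) $ p" for p
        using chain_polytope_nth(1)[OF r x, of p] chain_polytope_nth(1)[OF s y, of p] by simp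
      fix K assume "K \<in> Chains r \<union> Chains s"
      then show "(\<Sum>p\<in>K. (x + y) $ p) \<le> 1"
      proof
        assume K: "K \<in> Chains r"
        have "(\<Sum>p\<in>K. (x + y) $ p) = (\<Sum>p\<in>K. x $ p)"
          by (rule sum.cong) (use Chains_partial_order_subset[OF r K] AB y0 in auto)
        then show ?thesis using x K by (simp add: eqs)
      next
        assume K: "K \<in> Chains s"
        have "(\<Sum>p\<in>K. (x + y) $ p) = (\<Sum>p\<in>K. y $ p)"
          by (rule sum.cong) (use Chains_partial_order_subset[OF s K] AB x0 in auto)
        then show ?thesis using y K by (simp add: eqs)
      qed
    qed
  qed
qed

section \<open>Ordinal sums as wedges\<close>

lemma order_polytope_dual:
  assumes "partial_order_on A r"
  shows "x \<in> uminus ` order_polytope A (r\<inverse>) \<longleftrightarrow> indicator_vec A + x \<in> order_polytope A r"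
proof -
  have "x \<in> uminus ` order_polytope A (r\<inverse>) \<longleftrightarrow> - x \<in> order_polytope A (r\<inverse>)"
    by (metis add.inverse_inverse image_eqI imageE)
  also have "\<dots> \<longleftrightarrow> indicator_vec A + x \<in> order_polytope A r"
    unfolding order_polytope_def coord_space_def by (auto; force)
  finally show ?thesis .
qed

lemma order_polytope_eq_translated_dual:
  assumes "partial_order_on A r"
  shows "order_polytope A r = (+) (indicator_vec A) ` uminus ` order_polytope A (r\<inverse>)"
proof -
  have "x \<in> (+) (indicator_vec A) ` T \<longleftrightarrow> - indicator_vec A + x \<in> T" for x and T :: "(real ^ 'a) set"
    by (force simp: image_iff)
  then show ?thesis using order_polytope_dual[OF assms] by auto
qed

text \<open>Measured from the indicator of \<open>B\<close>, a point consists of its values on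
  \<open>A\<close> and its deficits from 1 on \<open>B\<close>. Every value on \<open>A\<close> lies
  below every value on \<open>B\<close>, so a threshold \<open>m\<close> bounds the former by
  \<open>m\<close> and the deficits by \<open>1 - m\<close>; these are the convex weights.\<close>

lemma order_polytope_ordinal_sum:
  assumes r: "partial_order_on A r" and s: "partial_order_on B s" and AB: "A \<inter> B = {}"
  shows "order_polytope (A \<union> B) (r \<union> s \<union> A \<times> B) = (+) (indicator_vec B) ` (\<lambda>(x, y). x + y) `
    (convex hull (wedge (order_polytope A r) (uminus ` order_polytope B (s\<inverse>))))"
    (is "?L = (+) ?b ` ?f ` (convex hull (wedge ?S ?T))")
proof -
  note rs = partial_order_onD(1)[OF r] partial_order_onD(1)[OF s]
  have ST: "convex ?S" "?S \<noteq> {}" "convex ?T" "?T \<noteq> {}"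
    using polyhedron_imp_convex[OF polyhedron_order_polytope]
      polyhedron_imp_convex[OF polyhedron_negations[OF polyhedron_order_polytope]]
      zero_in_order_polytope by blast+
  show ?thesis
  proof
    show "?L \<subseteq> (+) ?b ` ?f ` (convex hull (wedge ?S ?T))"
    proof
      fix z assume z: "z \<in> ?L"
      define m where "m = Max (insert 0 (($) z ` A))"
      have m0: "0 \<le> m" by (simp add: m_def)
      have mA: "z $ p \<le> m" if "p \<in> A" for p
        using that by (simp add: m_def)
      have m1: "m \<le> 1"
        using order_polytope_nth(2)[OF z] by (simp add: m_def)
      have mB: "m \<le> z $ q" if "q \<in> B" for q
        using z that by (auto simp: m_def order_polytope_def)
      \<comment> \<open>For \<open>m = 0\<close> or \<open>m = 1\<close> division by zero turns
        \<open>x\<close> or \<open>y\<close> into the origin. This is harmless, as the part of the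
        point being rescaled is then 0 too.\<close>
      define x where "x = (1 / m) *\<^sub>R coord_proj A z"
      define y where "y = (1 / (1 - m)) *\<^sub>R (coord_proj B z - ?b)"
      have "x \<in> ?S"
        using z m0 mA unfolding order_polytope_def coord_space_def
        by (auto simp: x_def divide_right_mono divide_le_eq_1)
      moreover have "y \<in> ?T"
      proof -
        have y_nth: "(- y) $ p = (if p \<in> B then (1 - z $ p) / (1 - m) else 0)" for p
          by (simp add: y_def minus_divide_left)
        have "- y \<in> order_polytope B (s\<inverse>)"
          unfolding order_polytope_def coord_space_def
        proof (intro CollectI conjI ballI impI allI)
          fix p
          show "(- y) $ p = 0" if "p \<notin> B" using that y_nth by simp
          show "0 \<le> (- y) $ p"
            using order_polytope_nth(2)[OF z, of p] m1 by (simp only: y_nth) simp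
          show "(- y) $ p \<le> 1"
            using mB[of p] m1 by (simp only: y_nth) (auto simp: divide_le_eq_1 less_le)
          fix q assume "p \<in> B" "q \<in> B" "(p, q) \<in> s\<inverse>"
          then show "(- y) $ p \<le> (- y) $ q"
            using z m1 by (simp only: y_nth) (auto simp: order_polytope_def intro!: divide_right_mono)
        qed
        then show ?thesis by (metis add.inverse_inverse image_eqI)
      qed
      ultimately have "(m *\<^sub>R x, (1 - m) *\<^sub>R y) \<in> convex hull (wedge ?S ?T)"
        using m0 m1 by (intro convex_hull_wedgeI[OF ST]) auto
      moreover have "z = ?b + ?f (m *\<^sub>R x, (1 - m) *\<^sub>R y)"
      proof -
        have "m *\<^sub>R x = coord_proj A z"
        proof (cases "m = 0")
          case True
          then have "z $ p = 0" if "p \<in> A" for p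
            using mA[OF that] order_polytope_nth(1)[OF z, of p] by simp
          then show ?thesis using True by (simp add: vec_eq_iff)
        qed (simp add: x_def)
        moreover have "(1 - m) *\<^sub>R y = coord_proj B z - ?b"
        proof (cases "m = 1")
          case True
          then have "z $ p = 1" if "p \<in> B" for p
            using mB[OF that] order_polytope_nth(2)[OF z, of p] by simp
          then show ?thesis using True by (simp add: vec_eq_iff)
        qed (simp add: y_def)
        moreover have "z \<in> coord_space (A \<union> B)"
          using z order_polytope_subset_coord_space by blast
        ultimately show ?thesis
          using coord_proj_decomp[OF AB] by simp
      qed
      ultimately show "z \<in> (+) ?b ` ?f ` (convex hull (wedge ?S ?T))" by blast
    qed
    show "(+) ?b ` ?f ` (convex hull (wedge ?S ?T)) \<subseteq> ?L"
    proof -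
      have "?b + (u *\<^sub>R x + v *\<^sub>R - y) \<in> ?L"
        if x: "x \<in> ?S" and y: "y \<in> order_polytope B (s\<inverse>)" and uv: "0 \<le> u" "0 \<le> v" "u + v = 1"
        for u v x y
      proof -
        let ?z = "?b + (u *\<^sub>R x + v *\<^sub>R - y)"
        have zA: "?z $ p = u * x $ p" if "p \<in> A" for p
        proof -
          have "p \<notin> B" using that AB by blast
          moreover from this have "y $ p = 0"
            using y by (simp add: order_polytope_def coord_space_def)
          ultimately show ?thesis by simp
        qed
        have zB: "?z $ p = 1 - v * y $ p" if "p \<in> B" for p
        proof -
          have "p \<notin> A" using that AB by blast
          then have "x $ p = 0"
            using x by (simp add: order_polytope_def coord_space_def)
          then show ?thesis using that by simp
        qed
        have x01: "0 \<le> u * x $ p" "u * x $ p \<le> u" for p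
          using order_polytope_nth[OF x, of p] uv by (auto simp: mult_left_le)
        have y01: "0 \<le> v * y $ p" "v * y $ p \<le> v" for p
          using order_polytope_nth[OF y, of p] uv by (auto simp: mult_left_le)
        show ?thesis
          unfolding order_polytope_def
        proof (intro CollectI conjI ballI impI)
          show "?z \<in> coord_space (A \<union> B)"
            using x y by (simp add: order_polytope_def coord_space_def)
          fix p assume p: "p \<in> A \<union> B"
          show "0 \<le> ?z $ p"
            using p zA[of p] zB[of p] x01[of p] y01[of p] uv by auto
          show "?z $ p \<le> 1"
            using p zA[of p] zB[of p] x01[of p] y01[of p] uv by auto
          fix q assume "(p, q) \<in> r \<union> s \<union> A \<times> B"
          then consider "(p, q) \<in> r" | "(p, q) \<in> s" | "p \<in> A" "q \<in> B" by blast
          then show "?z $ p \<le> ?z $ q"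
          proof cases
            case 1
            then have "p \<in> A" "q \<in> A" "x $ p \<le> x $ q"
              using rs x by (auto simp: order_polytope_def)
            then show ?thesis
              using zA uv by (simp only: mult_left_mono)
          next
            case 2
            then have "p \<in> B" "q \<in> B" "y $ q \<le> y $ p"
              using rs y by (auto simp: order_polytope_def)
            then show ?thesis
              using zB uv by (simp only: mult_left_mono diff_left_mono)
          next
            case 3
            then show ?thesis
              using zA[of p] zB[of q] x01[of p] y01[of q] uv by linarith
          qed
        qed
      qed
      then show ?thesis
        unfolding convex_hull_wedge[OF ST] by force
    qed
  qed
qed

text \<open>A chain of the ordinal sum is a chain of \<open>A\<close> followed by one of
  \<open>B\<close>, so the heaviest weights in \<open>A\<close> and in \<open>B\<close> add up to at
  most 1. The weight \<open>m\<close> of a heaviest chain in \<open>A\<close> serves as convex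
  coefficient.\<close>

lemma chain_polytope_ordinal_sum:
  assumes r: "partial_order_on A r" and s: "partial_order_on B s" and AB: "A \<inter> B = {}"
  shows "chain_polytope (A \<union> B) (r \<union> s \<union> A \<times> B) = (\<lambda>(x, y). x + y) `
    (convex hull (wedge (chain_polytope A r) (chain_polytope B s)))"
    (is "?L = ?f ` (convex hull (wedge ?S ?T))")
proof -
  note po = partial_order_on_ordinal_sum[OF assms]
  note eqs = chain_polytope_eq[OF r] chain_polytope_eq[OF s] chain_polytope_eq[OF po]
  note chains = Chains_ordinal_sum[OF assms]
  have ST: "convex ?S" "?S \<noteq> {}" "convex ?T" "?T \<noteq> {}"
    using polyhedron_imp_convex[OF polyhedron_chain_polytope]
      zero_in_chain_polytope r s by blast+
  show ?thesis
  proof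
    show "?L \<subseteq> ?f ` (convex hull (wedge ?S ?T))"
    proof
      fix z assume z: "z \<in> ?L"
      define w where "w K = (\<Sum>p\<in>K. z $ p)" for K
      define m where "m = Max (w ` Chains r)"
      have ne: "{} \<in> Chains r" "{} \<in> Chains s" by (auto simp: Chains_def)
      have m_ge: "w K \<le> m" if "K \<in> Chains r" for K
        using that by (simp add: m_def)
      have m0: "0 \<le> m" using m_ge[OF ne(1)] by (simp add: w_def)
      have "m \<in> w ` Chains r"
        unfolding m_def using ne by (intro Max_in) auto
      then obtain M where M: "M \<in> Chains r" "m = w M" by blast
      have mB: "m + w K \<le> 1" if "K \<in> Chains s" for K
      proof -
        have sub: "M \<subseteq> A" "K \<subseteq> B"
          using Chains_partial_order_subset[OF r M(1)] Chains_partial_order_subset[OF s that] by auto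
        then have "M \<inter> K = {}" "(M \<union> K) \<inter> A = M" "(M \<union> K) \<inter> B = K"
          using AB by auto
        then have "w (M \<union> K) = w M + w K" "M \<union> K \<in> Chains (r \<union> s \<union> A \<times> B)"
          using sub chains[of "M \<union> K"] M(1) that by (auto simp: w_def sum.union_disjoint)
        then show ?thesis
          using z M(2) by (auto simp: eqs w_def)
      qed
      then have m1: "m \<le> 1" using mB[OF ne(2)] by (simp add: w_def)
      have nonneg: "0 \<le> z $ p" for p by (rule chain_polytope_nth(1)[OF po z])
      define x where "x = (1 / m) *\<^sub>R coord_proj A z"
      define y where "y = (1 / (1 - m)) *\<^sub>R coord_proj B z"
      have "x \<in> ?S"
        unfolding eqs
      proof (intro CollectI conjI ballI)
        show "x \<in> coord_space A" by (simp add: x_def coord_space_def)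
        show "0 \<le> x $ p" for p using nonneg m0 by (simp add: x_def)
        fix K assume K: "K \<in> Chains r"
        have "(\<Sum>p\<in>K. x $ p) = (\<Sum>p\<in>K. z $ p / m)"
          by (rule sum.cong) (use Chains_partial_order_subset[OF r K] in \<open>auto simp: x_def\<close>)
        also have "\<dots> = w K / m" by (simp add: w_def sum_divide_distrib)
        also have "\<dots> \<le> 1"
          using m_ge[OF K] m0 by (auto simp: divide_le_eq_1 less_le)
        finally show "(\<Sum>p\<in>K. x $ p) \<le> 1" .
      qed
      moreover have "y \<in> ?T"
        unfolding eqs
      proof (intro CollectI conjI ballI)
        show "y \<in> coord_space B" by (simp add: y_def coord_space_def)
        show "0 \<le> y $ p" for p using nonneg m1 by (simp add: y_def)
        fix K assume K: "K \<in> Chains s"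
        have "(\<Sum>p\<in>K. y $ p) = (\<Sum>p\<in>K. z $ p / (1 - m))"
          by (rule sum.cong) (use Chains_partial_order_subset[OF s K] in \<open>auto simp: y_def\<close>)
        also have "\<dots> = w K / (1 - m)" by (simp add: w_def sum_divide_distrib)
        also have "\<dots> \<le> 1"
          using mB[OF K] m1 by (auto simp: divide_le_eq_1 less_le)
        finally show "(\<Sum>p\<in>K. y $ p) \<le> 1" .
      qed
      ultimately have "(m *\<^sub>R x, (1 - m) *\<^sub>R y) \<in> convex hull (wedge ?S ?T)"
        using m0 m1 by (intro convex_hull_wedgeI[OF ST]) auto
      moreover have "z = ?f (m *\<^sub>R x, (1 - m) *\<^sub>R y)"
      proof -
        have "m *\<^sub>R x = coord_proj A z"
        proof (cases "m = 0")
          case True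
          have "z $ p = 0" if "p \<in> A" for p
          proof -
            have "{p} \<in> Chains r"
              using partial_order_onD(2)[OF r that] by (simp add: Chains_def)
            then show ?thesis
              using m_ge[of "{p}"] True nonneg[of p] by (simp add: w_def)
          qed
          then show ?thesis using True by (simp add: vec_eq_iff)
        qed (simp add: x_def)
        moreover have "(1 - m) *\<^sub>R y = coord_proj B z"
        proof (cases "m = 1")
          case True
          have "z $ p = 0" if "p \<in> B" for p
          proof -
            have "{p} \<in> Chains s"
              using partial_order_onD(2)[OF s that] by (simp add: Chains_def)
            then show ?thesis
              using mB[of "{p}"] True nonneg[of p] by (simp add: w_def)
          qed
          then show ?thesis using True by (simp add: vec_eq_iff)
        qed (simp add: y_def)
        moreover have "z \<in> coord_space (A \<union> B)"
          using z chain_polytope_subset_coord_space by blast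
        ultimately show ?thesis
          using coord_proj_decomp[OF AB] by simp
      qed
      ultimately show "z \<in> ?f ` (convex hull (wedge ?S ?T))" by blast
    qed
    show "?f ` (convex hull (wedge ?S ?T)) \<subseteq> ?L"
    proof -
      have "u *\<^sub>R x + v *\<^sub>R y \<in> ?L"
        if x: "x \<in> ?S" and y: "y \<in> ?T" and uv: "0 \<le> u" "0 \<le> v" "u + v = 1" for u v x y
        unfolding eqs
      proof (intro CollectI conjI ballI)
        have xy: "x \<in> coord_space A" "y \<in> coord_space B"
          using x y by (auto simp: eqs)
        then show "u *\<^sub>R x + v *\<^sub>R y \<in> coord_space (A \<union> B)"
          by (simp add: coord_space_def)
        show "0 \<le> (u *\<^sub>R x + v *\<^sub>R y) $ p" for p
          using chain_polytope_nth(1)[OF r x, of p] chain_polytope_nth(1)[OF s y, of p] uv by simp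
        fix K assume "K \<in> Chains (r \<union> s \<union> A \<times> B)"
        then have K: "K \<inter> A \<in> Chains r" "K \<inter> B \<in> Chains s"
          using chains by auto
        have "(\<Sum>p\<in>K. (u *\<^sub>R x + v *\<^sub>R y) $ p) = u * (\<Sum>p\<in>K. x $ p) + v * (\<Sum>p\<in>K. y $ p)"
          by (simp add: sum.distrib sum_distrib_left)
        also have "\<dots> \<le> u * 1 + v * 1"
          using x y K uv sum_coord_space_Int[OF xy(1), of K] sum_coord_space_Int[OF xy(2), of K]
          by (intro add_mono mult_left_mono) (auto simp: eqs)
        finally show "(\<Sum>p\<in>K. (u *\<^sub>R x + v *\<^sub>R y) $ p) \<le> 1" using uv by simp
      qed
      then show ?thesis
        unfolding convex_hull_wedge[OF ST] by force
    qed
  qed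
qed

section \<open>Posets without an X\<close>

lemma X_le_eq: "X_le = Id \<union> {(Xa, Xc), (Xb, Xc), (Xc, Xd), (Xc, Xe), (Xa, Xd), (Xa, Xe), (Xb, Xd), (Xb, Xe)}"
  (is "_ = ?R")
proof
  let ?G = "{(Xa, Xc), (Xb, Xc), (Xc, Xd), (Xc, Xe)}"
  show "X_le \<subseteq> ?R"
  proof
    fix p assume "p \<in> X_le"
    then obtain x y where p: "p = (x, y)" "(x, y) \<in> ?G\<^sup>*"
      by (cases p) (auto simp: X_le_def)
    have "(x, y) \<in> ?R"
      using p(2) by (induction rule: rtrancl_induct) auto
    then show "p \<in> ?R" using p by simp
  qed
  have G: "?G \<subseteq> X_le" by (auto simp: X_le_def)
  have tr: "(x, z) \<in> X_le" if "(x, y) \<in> X_le" "(y, z) \<in> X_le" for x y z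
    using that unfolding X_le_def by (rule rtrancl_trans)
  show "?R \<subseteq> X_le"
    using G tr[of Xa Xc] tr[of Xb Xc] by (auto simp: X_le_def)
qed

text \<open>An incomparable pair below \<open>c\<close> and another above it would form, together
  with \<open>c\<close>, a copy of X.\<close>

lemma X_freeD:
  assumes po: "partial_order_on A r" and X: "X_free A r"
  shows "{q. (q, c) \<in> r} \<in> Chains r \<or> {q. (c, q) \<in> r} \<in> Chains r"
proof (rule ccontr)
  note tr = partial_order_onD[OF po]
  assume neg: "\<not> ?thesis"
  then obtain a b d e where below: "(a, c) \<in> r" "(b, c) \<in> r" "(a, b) \<notin> r" "(b, a) \<notin> r"
      and above: "(c, d) \<in> r" "(c, e) \<in> r" "(d, e) \<notin> r" "(e, d) \<notin> r"
    unfolding Chains_def by blast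
  have A: "a \<in> A" "b \<in> A" "c \<in> A" "d \<in> A" "e \<in> A" using below above tr(1) by auto
  have lt: "(a, d) \<in> r" "(a, e) \<in> r" "(b, d) \<in> r" "(b, e) \<in> r"
    using below above transD[OF tr(3)] by blast+
  have refl: "(a, a) \<in> r" "(b, b) \<in> r" "(c, c) \<in> r" "(d, d) \<in> r" "(e, e) \<in> r"
    using A tr(2) by auto
  have "(c, a) \<notin> r" "(c, b) \<notin> r" "(d, c) \<notin> r" "(e, c) \<notin> r"
    using below above transD[OF tr(3)] by blast+
  moreover from this have "(d, a) \<notin> r" "(d, b) \<notin> r" "(e, a) \<notin> r" "(e, b) \<notin> r"
    using below above transD[OF tr(3)] by blast+
  ultimately have ngt: "(c, a) \<notin> r" "(c, b) \<notin> r" "(d, c) \<notin> r" "(e, c) \<notin> r"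
      "(d, a) \<notin> r" "(d, b) \<notin> r" "(e, a) \<notin> r" "(e, b) \<notin> r" by blast+
  define f where "f = (\<lambda>x. case x of Xa \<Rightarrow> a | Xb \<Rightarrow> b | Xc \<Rightarrow> c | Xd \<Rightarrow> d | Xe \<Rightarrow> e)"
  have iff: "(x, y) \<in> X_le \<longleftrightarrow> (f x, f y) \<in> r" for x y
    using below above lt refl ngt unfolding X_le_eq f_def by (cases x; cases y) simp_all
  have "inj f"
  proof (rule injI)
    fix x y assume "f x = f y"
    then have "(x, y) \<in> X_le" "(y, x) \<in> X_le"
      using iff refl iff[of x x] by (auto simp: X_le_eq)
    then show "x = y" by (auto simp: X_le_eq)
  qed
  then have "poset_isomorphic UNIV X_le (range f) (Restr r (range f))"
    unfolding poset_isomorphic_def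
    using iff by (intro exI[of _ f]) (auto simp: bij_betw_def)
  moreover have "range f \<subseteq> A"
    using A by (auto simp: f_def split: X_elem.splits)
  ultimately show False
    using X unfolding X_free_def by blast
qed

text \<open>The hypothesis splits the poset into a down-set in which every principal ideal is a chain and
  an up-set in which every principal filter is a chain. Stanley's transfer map, applied upwards on
  the former and downwards on the latter, is then affine.\<close>

lemma simplex_face_count_X_free:
  fixes A :: "'n::finite set"
  assumes po: "partial_order_on A r" and X: "X_free A r"
  shows "simplex_face_count k (order_polytope A r) = simplex_face_count k (chain_polytope A r)"
proof -
  note tr = partial_order_onD[OF po]
  note eq = chain_polytope_eq[OF po]
  let ?dn = "\<lambda>p. {q. q \<in> A \<and> (q, p) \<in> r}" and ?up = "\<lambda>p. {q. q \<in> A \<and> (p, q) \<in> r}"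
  define D where "D = {p \<in> A. ?dn p \<in> Chains r}"
  define U where "U = A - D"
  have DU: "D \<subseteq> A" "U \<subseteq> A" "D \<union> U = A" "D \<inter> U = {}" by (auto simp: D_def U_def)
  have D_down: "p \<in> D" if "q \<in> D" "(p, q) \<in> r" for p q
  proof -
    have "?dn p \<subseteq> ?dn q" using that transD[OF tr(3)] by blast
    then show ?thesis using that tr(1) Chains_subset by (auto simp: D_def)
  qed
  have U_up: "q \<in> U" if "p \<in> U" "(p, q) \<in> r" for p q
    using that D_down tr(1) by (auto simp: U_def)
  have dn_chain: "?dn p \<in> Chains r" if "p \<in> D" for p
    using that by (simp add: D_def)
  have up_chain: "?up p \<in> Chains r" if "p \<in> U" for p
  proof -
    have "{q. (q, p) \<in> r} \<notin> Chains r"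
      using that Chains_subset[of "{q. (q, p) \<in> r}" r "?dn p"] by (auto simp: U_def D_def)
    then have "{q. (p, q) \<in> r} \<in> Chains r"
      using X_freeD[OF po X] by blast
    then show ?thesis by (rule Chains_subset) auto
  qed
  \<comment> \<open>The linear part of the inverse transfer map. Its constant part, 1 on
    \<open>U\<close>, is split off as the translation by \<open>indicator_vec U\<close>.\<close>
  define g :: "real ^ 'n \<Rightarrow> real ^ 'n" where
    "g y = (\<chi> p. if p \<in> D then \<Sum>q\<in>?dn p. y $ q else if p \<in> U then - (\<Sum>q\<in>?up p. y $ q) else 0)" for y
  have gD: "g y $ p = (\<Sum>q\<in>?dn p. y $ q)" if "p \<in> D" for y p
    using that by (simp add: g_def)
  have gU: "g y $ p = - (\<Sum>q\<in>?up p. y $ q)" if "p \<in> U" for y p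
    using that DU by (auto simp: g_def)
  have g0: "g y $ p = 0" if "p \<notin> A" for y p
    using that DU by (auto simp: g_def)
  have lin: "linear g"
    by (auto simp: linear_iff vec_eq_iff g_def sum.distrib sum_distrib_left)
  have inj: "inj_on g (coord_space A)"
  proof (rule inj_onI)
    fix x y assume xy: "x \<in> coord_space A" "y \<in> coord_space A" "g x = g y"
    define w where "w = x - y"
    have w: "g w = 0" using xy(3) by (simp add: w_def linear_diff[OF lin])
    have "w $ p = 0" for p
    proof -
      consider "p \<in> D" | "p \<in> U" | "p \<notin> A" using DU by blast
      then show ?thesis
      proof cases
        case 1
        show ?thesis
        proof (rule vanishing_if_downset_sums_vanish[where A = A and r = r and B = D])
          show "(\<Sum>q\<in>?dn p. w $ q) = 0" if "p \<in> D" for p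
            using gD[OF that, of w] w by simp
        qed (use tr DU D_down 1 in auto)
      next
        case 2
        show ?thesis
        proof (rule vanishing_if_downset_sums_vanish[where A = A and r = "r\<inverse>" and B = U])
          show "(\<Sum>q | q \<in> A \<and> (q, p) \<in> r\<inverse>. w $ q) = 0" if "p \<in> U" for p
            using gU[OF that, of w] w by simp
        qed (use tr DU U_up 2 in auto)
      next
        case 3
        then show ?thesis using xy by (simp add: w_def coord_space_def)
      qed
    qed
    then show "x = y" by (simp add: w_def vec_eq_iff)
  qed
  have "subspace (coord_space A)"
    by (simp add: subspace_def coord_space_def)
  then obtain h where h: "linear h" "\<forall>v\<in>coord_space A. h (g v) = v"
    using linear_exists_left_inverse_on[OF lin _ inj] by blast
  have "order_polytope A r = (+) (indicator_vec U) ` g ` chain_polytope A r"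
  proof
    show "(+) (indicator_vec U) ` g ` chain_polytope A r \<subseteq> order_polytope A r"
    proof clarify
      fix y assume y: "y \<in> chain_polytope A r"
      note nonneg = chain_polytope_nth(1)[OF po y]
      have chain: "(\<Sum>p\<in>K. y $ p) \<le> 1" if "K \<in> Chains r" for K
        using y that by (simp add: eq)
      let ?x = "indicator_vec U + g y"
      have xD: "?x $ p = (\<Sum>q\<in>?dn p. y $ q)" if "p \<in> D" for p
        using gD[OF that] DU that by auto
      have xU: "?x $ p = 1 - (\<Sum>q\<in>?up p. y $ q)" if "p \<in> U" for p
        using gU[OF that] that by simp
      have sums: "0 \<le> (\<Sum>q\<in>K. y $ q)" for K by (simp add: nonneg sum_nonneg)
      show "?x \<in> order_polytope A r"
        unfolding order_polytope_def
      proof (intro CollectI conjI ballI impI)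
        show "?x \<in> coord_space A"
          using g0 DU by (auto simp: coord_space_def)
        fix p assume p: "p \<in> A"
        show "0 \<le> ?x $ p"
        proof (cases "p \<in> D")
          case True
          then show ?thesis using sums by (simp only: xD)
        next
          case False
          then have "p \<in> U" using p DU by blast
          then show ?thesis using chain[OF up_chain] by (simp only: xU) simp
        qed
        show "?x $ p \<le> 1"
        proof (cases "p \<in> D")
          case True
          then show ?thesis using chain[OF dn_chain] by (simp only: xD)
        next
          case False
          then have "p \<in> U" using p DU by blast
          then show ?thesis using sums by (simp only: xU) simp
        qed
        fix q assume q: "q \<in> A" and pq: "(p, q) \<in> r"
        consider "p \<in> D" "q \<in> D" | "p \<in> U" "q \<in> U" | "p \<in> D" "q \<in> U"
          using p q pq DU U_up by blast
        then show "?x $ p \<le> ?x $ q"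
        proof cases
          case 1
          have "?dn p \<subseteq> ?dn q" using pq transD[OF tr(3)] by blast
          then have "(\<Sum>i\<in>?dn p. y $ i) \<le> (\<Sum>i\<in>?dn q. y $ i)"
            by (intro sum_mono2) (auto simp: nonneg)
          then show ?thesis using 1 by (simp only: xD)
        next
          case 2
          have "?up q \<subseteq> ?up p" using pq transD[OF tr(3)] by blast
          then have "(\<Sum>i\<in>?up q. y $ i) \<le> (\<Sum>i\<in>?up p. y $ i)"
            by (intro sum_mono2) (auto simp: nonneg)
          then show ?thesis using 2 by (simp only: xU)
        next
          \<comment> \<open>The chain below \<open>p\<close> and the chain above \<open>q\<close>
            join to one chain; its weight being at most 1 is exactly the required
            inequality.\<close>
          case 3
          have cross: "(i, j) \<in> r" if "i \<in> ?dn p" "j \<in> ?up q" for i j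
            using that pq transD[OF tr(3)] by blast
          have "?dn p \<union> ?up q \<in> Chains r"
            using dn_chain[OF 3(1)] up_chain[OF 3(2)] cross unfolding Chains_def by blast
          moreover have "?dn p \<inter> ?up q = {}"
            using 3 D_down U_up DU by blast
          ultimately have "(\<Sum>i\<in>?dn p. y $ i) + (\<Sum>i\<in>?up q. y $ i) \<le> 1"
            using chain[of "?dn p \<union> ?up q"] by (simp add: sum.union_disjoint)
          then show ?thesis using 3 by (simp only: xD xU)
        qed
      qed
    qed
    show "order_polytope A r \<subseteq> (+) (indicator_vec U) ` g ` chain_polytope A r"
    proof
      fix x assume x: "x \<in> order_polytope A r"
      have mono: "x $ p \<le> x $ q" if "(p, q) \<in> r" for p q
        using x that tr(1) by (auto simp: order_polytope_def)
      note bounds = order_polytope_nth[OF x]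
      \<comment> \<open>On \<open>U\<close> the transfer map is applied to the heights 1 - x over
        the dual order.\<close>
      define y :: "real ^ 'n" where
        "y = (\<chi> p. if p \<in> D then increment r A (($) x) p
                   else if p \<in> U then increment (r\<inverse>) A (\<lambda>p. 1 - x $ p) p else 0)"
      have yD: "y $ p = increment r A (($) x) p" if "p \<in> D" for p
        using that by (simp add: y_def)
      have yU: "y $ p = increment (r\<inverse>) A (\<lambda>p. 1 - x $ p) p" if "p \<in> U" for p
        using that DU by (auto simp: y_def)
      have y0: "y $ p = 0" if "p \<notin> A" for p
        using that DU by (auto simp: y_def)
      have nonneg: "0 \<le> y $ p" for p
      proof -
        consider "p \<in> D" | "p \<in> U" | "p \<notin> A" using DU by blast
        then show ?thesis
        proof cases
          case 1
          show ?thesis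
            unfolding yD[OF 1] by (rule increment_nonneg) (use bounds mono in auto)
        next
          case 2
          show ?thesis
            unfolding yU[OF 2] by (rule increment_nonneg) (use bounds mono in auto)
        qed (simp add: y0)
      qed
      have sumD: "(\<Sum>q\<in>?dn p. y $ q) = x $ p" if "p \<in> D" for p
      proof -
        have "(\<Sum>q\<in>?dn p. y $ q) = (\<Sum>q\<in>?dn p. increment r A (($) x) q)"
          by (rule sum.cong) (use that D_down yD in auto)
        also have "\<dots> = x $ p"
          by (rule sum_increments) (use tr bounds mono that DU dn_chain in auto)
        finally show ?thesis .
      qed
      have sumU: "(\<Sum>q\<in>?up p. y $ q) = 1 - x $ p" if "p \<in> U" for p
      proof -
        have "(\<Sum>q\<in>?up p. y $ q)
            = (\<Sum>q | q \<in> A \<and> (q, p) \<in> r\<inverse>. increment (r\<inverse>) A (\<lambda>p. 1 - x $ p) q)"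
          by (rule sum.cong) (use that U_up yU in auto)
        also have "\<dots> = 1 - x $ p"
          by (rule sum_increments) (use tr bounds mono that DU up_chain in auto)
        finally show ?thesis .
      qed
      have "y \<in> chain_polytope A r"
        unfolding eq
      proof (intro CollectI conjI ballI)
        show "y \<in> coord_space A" using y0 by (simp add: coord_space_def)
        show "0 \<le> y $ p" for p by (rule nonneg)
        fix K assume K: "K \<in> Chains r"
        have KA: "K \<subseteq> A" by (rule Chains_partial_order_subset[OF po K])
        \<comment> \<open>The part of \<open>K\<close> in \<open>D\<close> weighs at most the value
          of \<open>x\<close> at its top, the part in \<open>U\<close> at most 1 minus the value at
          its bottom. By monotonicity of \<open>x\<close> the two bounds add up to at most
          1.\<close>
        have low: "K \<inter> D = {} \<or> (\<exists>m\<in>K \<inter> D. (\<Sum>p\<in>K \<inter> D. y $ p) \<le> x $ m)"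
        proof (cases "K \<inter> D = {}")
          case False
          then obtain m where m: "m \<in> K \<inter> D" "\<forall>q\<in>K \<inter> D. (q, m) \<in> r"
            using finite_chain_has_max[of "K \<inter> D" r] Chains_subset[OF K, of "K \<inter> D"] tr(3) by auto
          have "(\<Sum>p\<in>K \<inter> D. y $ p) \<le> (\<Sum>p\<in>?dn m. y $ p)"
            by (rule sum_mono2) (use m DU nonneg in auto)
          then show ?thesis using m sumD by auto
        qed simp
        have high: "K \<inter> U = {} \<or> (\<exists>m\<in>K \<inter> U. (\<Sum>p\<in>K \<inter> U. y $ p) \<le> 1 - x $ m)"
        proof (cases "K \<inter> U = {}")
          case False
          then obtain m where m: "m \<in> K \<inter> U" "\<forall>q\<in>K \<inter> U. (q, m) \<in> r\<inverse>"
            using finite_chain_has_max[of "K \<inter> U" "r\<inverse>"] Chains_subset[OF K, of "K \<inter> U"] tr(3) by auto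
          have "(\<Sum>p\<in>K \<inter> U. y $ p) \<le> (\<Sum>p\<in>?up m. y $ p)"
            by (rule sum_mono2) (use m DU nonneg in auto)
          then show ?thesis using m sumU by auto
        qed simp
        have "(\<Sum>p\<in>K. y $ p) = (\<Sum>p\<in>K \<inter> D. y $ p) + (\<Sum>p\<in>K \<inter> U. y $ p)"
          by (subst sum.union_disjoint[symmetric])
             (use KA DU in \<open>auto intro!: sum.cong\<close>)
        also have "\<dots> \<le> 1"
          using low
        proof
          assume "K \<inter> D = {}"
          moreover have "(\<Sum>p\<in>K \<inter> U. y $ p) \<le> 1"
            using high bounds(1) by (force intro: order_trans)
          ultimately show ?thesis by simp
        next
          assume "\<exists>m\<in>K \<inter> D. (\<Sum>p\<in>K \<inter> D. y $ p) \<le> x $ m"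
          then obtain m where m: "m \<in> K" "m \<in> D" "(\<Sum>p\<in>K \<inter> D. y $ p) \<le> x $ m" by auto
          show ?thesis
            using high
          proof
            assume "K \<inter> U = {}"
            then show ?thesis using m(3) bounds(2)[of m] by simp
          next
            assume "\<exists>m\<in>K \<inter> U. (\<Sum>p\<in>K \<inter> U. y $ p) \<le> 1 - x $ m"
            then obtain m' where m': "m' \<in> K" "m' \<in> U" "(\<Sum>p\<in>K \<inter> U. y $ p) \<le> 1 - x $ m'" by auto
            \<comment> \<open>Otherwise the down-set \<open>D\<close> would contain
              \<open>m'\<close>.\<close>
            have "(m', m) \<notin> r" using D_down[OF m(2)] m'(2) by (auto simp: U_def)
            then have "(m, m') \<in> r" using K m m' unfolding Chains_def by blast
            then show ?thesis using mono[of m m'] m m' by linarith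
          qed
        qed
        finally show "(\<Sum>p\<in>K. y $ p) \<le> 1" .
      qed
      moreover have "x = indicator_vec U + g y"
      proof (rule vec_eq_iff[THEN iffD2], rule allI)
        fix p
        consider "p \<in> D" | "p \<in> U" | "p \<notin> A" using DU by blast
        then show "x $ p = (indicator_vec U + g y) $ p"
        proof cases
          case 1
          then have "p \<notin> U" by (simp add: U_def)
          then show ?thesis using gD[OF 1] sumD[OF 1] by simp
        next
          case 2
          then show ?thesis using gU[OF 2] sumU[OF 2] by simp
        next
          case 3
          then have "p \<notin> U" "x $ p = 0"
            using DU x by (auto simp: order_polytope_def coord_space_def)
          then show ?thesis using g0[OF 3] by simp
        qed
      qed
      ultimately show "x \<in> (+) (indicator_vec U) ` g ` chain_polytope A r" by blast
    qed
  qed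
  moreover have "simplex_face_count k (g ` chain_polytope A r) = simplex_face_count k (chain_polytope A r)"
    by (rule simplex_face_count_linear_image[OF lin h(1)])
       (use h(2) chain_polytope_subset_coord_space in blast)
  ultimately show ?thesis
    by (simp add: simplex_face_count_translation)
qed

section \<open>The inequality\<close>

lemma simplex_face_count_disjoint_union:
  assumes r: "partial_order_on A r" and s: "partial_order_on B s" and AB: "A \<inter> B = {}"
    and leA: "\<And>k. simplex_face_count k (order_polytope A r) \<le> simplex_face_count k (chain_polytope A r)"
    and leB: "\<And>k. simplex_face_count k (order_polytope B s) \<le> simplex_face_count k (chain_polytope B s)"
  shows "simplex_face_count k (order_polytope (A \<union> B) (r \<union> s))
       \<le> simplex_face_count k (chain_polytope (A \<union> B) (r \<union> s))"
proof -
  have "simplex_face_count k (order_polytope (A \<union> B) (r \<union> s))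
      = simplex_face_count k (order_polytope A r \<times> order_polytope B s)"
    unfolding order_polytope_disjoint_union[OF r s AB]
    by (rule simplex_face_count_add_image[OF AB])
       (use order_polytope_subset_coord_space in blast)
  also have "\<dots> \<le> simplex_face_count k (chain_polytope A r \<times> chain_polytope B s)"
    using leA leB
    by (simp add: simplex_face_count_Times polyhedron_order_polytope polyhedron_chain_polytope r s
        add_mono mult_mono)
  also have "\<dots> = simplex_face_count k (chain_polytope (A \<union> B) (r \<union> s))"
    unfolding chain_polytope_disjoint_union[OF r s AB]
    by (rule simplex_face_count_add_image[OF AB, symmetric])
       (use chain_polytope_subset_coord_space in blast)
  finally show ?thesis .
qed

lemma convex_hull_wedge_subset_coord_space:
  assumes "S \<subseteq> coord_space A" "T \<subseteq> coord_space B"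
  shows "convex hull (wedge S T) \<subseteq> coord_space A \<times> coord_space B"
proof (rule hull_minimal)
  show "wedge S T \<subseteq> coord_space A \<times> coord_space B"
    using assms by (auto simp: coord_space_def)
  show "convex (coord_space A \<times> coord_space B)"
    by (intro convex_Times polyhedron_imp_convex polyhedron_coord_space)
qed

lemma simplex_face_count_ordinal_sum:
  assumes r: "partial_order_on A r" and s: "partial_order_on B s" and AB: "A \<inter> B = {}"
    and leA: "\<And>k. simplex_face_count k (order_polytope A r) \<le> simplex_face_count k (chain_polytope A r)"
    and leB: "\<And>k. simplex_face_count k (order_polytope B s) \<le> simplex_face_count k (chain_polytope B s)"
  shows "simplex_face_count k (order_polytope (A \<union> B) (r \<union> s \<union> A \<times> B))
       \<le> simplex_face_count k (chain_polytope (A \<union> B) (r \<union> s \<union> A \<times> B))"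
proof -
  define OA where "OA = order_polytope A r"
  define OB where "OB = uminus ` order_polytope B (s\<inverse>)"
  define CA where "CA = chain_polytope A r"
  define CB where "CB = chain_polytope B s"
  have s': "partial_order_on B (s\<inverse>)" using s by simp
  have poly: "polyhedron OA" "polyhedron OB" "polyhedron CA" "polyhedron CB"
    unfolding OA_def OB_def CA_def CB_def
    by (intro polyhedron_negations polyhedron_order_polytope polyhedron_chain_polytope r s)+
  have ext: "0 extreme_point_of OA" "0 extreme_point_of OB" "0 extreme_point_of CA" "0 extreme_point_of CB"
    unfolding OA_def OB_def CA_def CB_def
    by (intro zero_extreme_point_uminus zero_extreme_point_order_polytope
        zero_extreme_point_chain_polytope r s)+
  have sub: "OA \<subseteq> coord_space A" "OB \<subseteq> coord_space B" "CA \<subseteq> coord_space A" "CB \<subseteq> coord_space B"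
    unfolding OA_def OB_def CA_def CB_def
    by (auto simp: order_polytope_def chain_polytope_def coord_space_def)
  \<comment> \<open>Reflection and translation leave the total count unchanged. What changes is the
    distinguished vertex, which is now the all-ones vertex of the order polytope of
    \<open>B\<close>.\<close>
  have countB: "simplex_face_count k OB = simplex_face_count k (order_polytope B s)" for k
    unfolding OB_def order_polytope_eq_translated_dual[OF s] by (simp add: simplex_face_count_translation)
  note split = simplex_face_count_split[OF finite_simplex_vertex_sets]
  have "simplex_face_count k (order_polytope (A \<union> B) (r \<union> s \<union> A \<times> B))
      = simplex_face_count k (convex hull (wedge OA OB))"
    unfolding order_polytope_ordinal_sum[OF r s AB] simplex_face_count_translation
      OA_def[symmetric] OB_def[symmetric]
    by (rule simplex_face_count_add_image[OF AB convex_hull_wedge_subset_coord_space[OF sub(1,2)]])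
  also have "\<dots> \<le> simplex_face_count k (convex hull (wedge CA CB))"
    unfolding simplex_face_count_wedge[OF poly(1) ext(1) poly(2) ext(2)]
      simplex_face_count_wedge[OF poly(3) ext(3) poly(4) ext(4)]
  proof (rule wedge_convolution_mono)
    fix i
    show "faces_at_origin i OA + faces_off_origin (Suc i) OA
        \<le> faces_at_origin i CA + faces_off_origin (Suc i) CA"
      using leA[of i] by (simp add: OA_def CA_def split[OF polyhedron_order_polytope]
          split[OF polyhedron_chain_polytope[OF r]])
    show "faces_at_origin i OB + faces_off_origin (Suc i) OB
        \<le> faces_at_origin i CB + faces_off_origin (Suc i) CB"
      using leB[of i] unfolding countB[symmetric] CB_def[symmetric] split[OF poly(2)] split[OF poly(4)] .
    show "faces_at_origin i CA \<le> faces_at_origin i OA"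
      unfolding CA_def OA_def
      using faces_at_origin_chain_polytope_le[OF r] faces_at_origin_order_polytope_ge[OF r]
      by (rule order_trans)
    \<comment> \<open>The chain polytope of \<open>B\<close> and the order polytope of its dual are
      compared through the chains, which do not see the direction of the order.\<close>
    have "faces_at_origin i CB \<le> card {K \<in> Chains (s\<inverse>). card K = i}"
      unfolding CB_def Chains_converse by (rule faces_at_origin_chain_polytope_le[OF s])
    also have "\<dots> \<le> faces_at_origin i OB"
      unfolding OB_def faces_at_origin_uminus_image by (rule faces_at_origin_order_polytope_ge[OF s'])
    finally show "faces_at_origin i CB \<le> faces_at_origin i OB" .
  qed (simp_all add: faces_off_origin_0 faces_at_origin_le_faces_off_origin poly)
  also have "\<dots> = simplex_face_count k (chain_polytope (A \<union> B) (r \<union> s \<union> A \<times> B))"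
    unfolding chain_polytope_ordinal_sum[OF r s AB] CA_def[symmetric] CB_def[symmetric]
    by (rule simplex_face_count_add_image[OF AB convex_hull_wedge_subset_coord_space[OF sub(3,4)],
          symmetric])
  finally show ?thesis .
qed

lemma X_family_partial_order:
  "X_family A r \<Longrightarrow> partial_order_on A r"
  by (induction rule: X_family.induct)
     (simp_all add: partial_order_on_disjoint_union partial_order_on_ordinal_sum)

theorem theorem4p1:
  fixes A :: "'n::finite set" and r :: "'n rel" and k :: nat
  assumes "X_family A r"
  shows "simplex_face_count k (order_polytope A r) \<le> simplex_face_count k (chain_polytope A r)"
  using assms
proof (induction arbitrary: k rule: X_family.induct)
  case (X_free A r)
  then show ?case by (simp add: simplex_face_count_X_free)
next
  case (disjoint_union A r B s)
  then show ?case
    by (intro simplex_face_count_disjoint_union X_family_partial_order)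
next
  case (ordinal_sum A r B s)
  then show ?case
    by (intro simplex_face_count_ordinal_sum X_family_partial_order)
qed

end
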